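(* Let $d\ge 2$, let $n_1,\dots,n_d$ be positive integers, and let $k_i\ge 0$, $s_i\geq 0$ ($i=1,\dots,d-1$) be integers. Let $A\in\mathcal{M}_{=(k_{1},\dots,k_{d-1})}^{n_{1}\times\dots\times n_{d}}$ be a singular point of $\mathcal{M}_{\leq(k_{1}+s_{1},\dots,k_{d-1}+s_{d-1})}^{n_{1}\times\dots\times n_{d}}$, and let $A_{1}\in\mathbb{R}^{n_{1}\times k_{1}}$, $A_{i}\in\mathbb{R}^{k_{i-1}\times n_{i}\times k_{i}}$ ($i=2,\dots,d-1$), $A_{d}\in\mathbb{R}^{k_{d-1}\times n_{d}}$ be tensors such that $A_{1}A_2\cdots A_{d}=A$, $A_{1}^{T}A_{1}=I$ and $(A_{i}^{R})^{T}A_{i}^{R}=I$ for all $i=2,\dots,d-1$. Then every vector $\mathcal{X}$ in the tangent cone $T_A\mathcal{M}_{\leq(k_{1}+s_{1},\dots,k_{d-1}+s_{d-1})}^{n_{1}\times\dots\times n_{d}}$ can be written as the TT tensor $$\mathcal{X}=\begin{pmatrix} A_{1} & U_{1} & X_{1} \end{pmatrix}\begin{pmatrix} A_{2} & U_{2} & X_{2} \\ 0 & Z_{2} & V_{2} \\ 0 & 0 & A_{2} \end{pmatrix}\cdots\begin{pmatrix} A_{d-1} & U_{d-1} & X_{d-1} \\ 0 & Z_{d-1} & V_{d-1} \\ 0 & 0 & A_{d-1} \end{pmatrix}\begin{pmatrix} X_{d} \\ V_{d} \\ A_{d} \end{pmatrix}$$ for some tensors $U_1\in\mathbb{R}^{n_1\times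 s_1}$, $X_1\in\mathbb{R}^{n_1\times k_1}$; $U_i\in\mathbb{R}^{k_{i-1}\times n_i\times s_i}$, $X_i\in\mathbb{R}^{k_{i-1}\times n_i\times k_i}$, $Z_i\in\mathbb{R}^{s_{i-1}\times n_i\times s_i}$, $V_i\in\mathbb{R}^{s_{i-1}\times n_i\times k_i}$ ($2\le i\le d-1$); $X_d\in\mathbb{R}^{k_{d-1}\times n_d}$, $V_d\in\mathbb{R}^{s_{d-1}\times n_d}$, satisfying $(A_{i}^{R})^{T}U_{i}^{R}=0$ for all $i=1,\dots,d-1$, $(A_{i}^{R})^{T}X_{i}^{R}=0$ for all $i=1,\dots,d-1$, and $(V_{i}A_{i+1}\cdots A_{d})^{L}\left((A_{i}A_{i+1}\cdots A_{d})^{L}\right)^{T}=0$ for all $i=2,\dots,d$.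
   Context: Tensors are elements of $\mathbb{R}^{m_1\times\dots\times m_r}$, with the standard Euclidean scalar product. $A^{(n_1\dots n_i)\times(n_{i+1}\dots n_d)}$ denotes the matricization of $A\in\mathbb{R}^{n_1\times\dots\times n_d}$ obtained by grouping the first $i$ indices as row index and the remaining ones as column index (lexicographic order). Shorthand: $B^L$ is the matricization with the first index as row index and all others as column index; $B^R$ is the matricization with the last index as column index and all others as row index (for a matrix, $B^L=B^R=B$). TT product: for $A\in\mathbb{R}^{n_1\times\dots\times n_i\times k}$ and $B\in\mathbb{R}^{k\times n_{i+1}\times\dots\times n_d}$, $AB\in\mathbb{R}^{n_1\times\dots\times n_d}$ has entries $(AB)(j_1,\dots,j_d)=\sum_{m=1}^kA(j_1,\dots,j_i,m)B(m,j_{i+1},\dots,j_d)$; it is associative. A block matrix whose blocks are order 3 tensors denotes the order 3 tensor obtained by placing the blocks along the first index (block rows) and last index (block columns), the middle index being shared; i.e. for each fixed middle index it is the corresponding block matrix. TT variety and TT manifold: $\mathcal{M}_{\leq(r_{1},\dots,r_{d-1})}^{n_{1}\times\dots\times n_{d}}=\{A\in\mathbb{R}^{n_{1}\times\dots\times n_{d}}:\forall i:\operatorname{rank}(A^{(n_{1}\dots n_{i})\times(n_{i+1}\dots n_{d})})\leq r_{i}\}$, and $\mathcal{M}_{=(r_{1},\dots,r_{d-1})}^{n_{1}\times\dots\times n_{d}}$ is defined by the same condition with $=$ in place of $\le$. Tangent cone (Bouligand contingent cone) of $\mathcal{M}\subset\mathbb{R}^N$ at $A\in\mathcal{M}$: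 $T_{A}\mathcal{M}=\{\xi\in\mathbb{R}^{N}:\exists(x_{n})\subset\mathcal{M},(a_{n})\subset\mathbb{R}^{+}\text{ s.t. }x_{n}\rightarrow A,\ a_{n}(x_{n}-A)\rightarrow\xi\}$. "Singular point" has its usual meaning for an algebraic variety (a point that is not a smooth point). *)

theory Defs
  imports
    "HOL-Analysis.Analysis"
    "HOL-Library.Function_Algebras"
    "Jordan_Normal_Form.DL_Rank"
begin

section \<open>Tensors\<close>

definition multi_indices :: "nat list \<Rightarrow> nat list set" where
  "multi_indices ns = {js. list_all2 (<) js ns}"

text \<open>
  A tensor consists of its shape and its entries. Multi-indices are 0-based, and the entry
  function is 0 outside the index range, so that two tensors of the same shape are equal
  iff their entry functions are.
\<close>

typedef tensor =
  "{(ns :: nat list, f :: nat list \<Rightarrow> real). \<forall>js. js \<notin> multi_indices ns \<longrightarrow> f js = 0}"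
  by (rule exI[of _ "([], \<lambda>_. 0)"]) simp

definition dims :: "tensor \<Rightarrow> nat list" where
  "dims A = fst (Rep_tensor A)"

definition entry :: "tensor \<Rightarrow> nat list \<Rightarrow> real" where
  "entry A = snd (Rep_tensor A)"

definition mk_tensor :: "nat list \<Rightarrow> (nat list \<Rightarrow> real) \<Rightarrow> tensor" where
  "mk_tensor ns f = Abs_tensor (ns, \<lambda>js. if js \<in> multi_indices ns then f js else 0)"

definition tensors :: "nat list \<Rightarrow> tensor set" where
  "tensors ns = {A. dims A = ns}"

lemma dims_mk_tensor [simp]: "dims (mk_tensor ns f) = ns"
  unfolding dims_def mk_tensor_def by (subst Abs_tensor_inverse) auto

lemma entry_mk_tensor:
  "entry (mk_tensor ns f) js = (if js \<in> multi_indices ns then f js else 0)"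
  unfolding entry_def mk_tensor_def by (subst Abs_tensor_inverse) auto

lemma entry_outside: "js \<notin> multi_indices (dims A) \<Longrightarrow> entry A js = 0"
  using Rep_tensor[of A] by (auto simp: entry_def dims_def case_prod_beta)

lemma tensor_eqI:
  assumes "dims A = dims B" and "\<And>js. js \<in> multi_indices (dims A) \<Longrightarrow> entry A js = entry B js"
  shows "A = B"
proof -
  have "entry A = entry B"
    using assms entry_outside by (metis ext)
  with assms(1) have "Rep_tensor A = Rep_tensor B"
    by (simp add: dims_def entry_def prod_eq_iff)
  then show ?thesis
    by (simp add: Rep_tensor_inject)
qed

definition zero_tensor :: "nat list \<Rightarrow> tensor" where
  "zero_tensor ns = mk_tensor ns (\<lambda>_. 0)"

text \<open>
  The contraction of the last index of \<open>A\<close> with the first index of \<open>B\<close>.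
  It is meant for \<open>last (dims A) = hd (dims B)\<close>.
\<close>

definition tt_mult :: "tensor \<Rightarrow> tensor \<Rightarrow> tensor" (infixr "\<star>" 70) where
  "A \<star> B = mk_tensor (butlast (dims A) @ tl (dims B))
     (\<lambda>js. let i = length (dims A) - 1 in
        \<Sum>m<last (dims A). entry A (take i js @ [m]) * entry B (m # drop i js))"

fun tt_prod :: "tensor list \<Rightarrow> tensor" where
  "tt_prod [] = undefined"
| "tt_prod [A] = A"
| "tt_prod (A # B # As) = A \<star> tt_prod (B # As)"

definition join_last :: "tensor \<Rightarrow> tensor \<Rightarrow> tensor" where
  "join_last A B = mk_tensor (butlast (dims A) @ [last (dims A) + last (dims B)])
     (\<lambda>js. if last js < last (dims A) then entry A js
           else entry B (butlast js @ [last js - last (dims A)]))"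

definition join_first :: "tensor \<Rightarrow> tensor \<Rightarrow> tensor" where
  "join_first A B = mk_tensor ((hd (dims A) + hd (dims B)) # tl (dims A))
     (\<lambda>js. if hd js < hd (dims A) then entry A js
           else entry B ((hd js - hd (dims A)) # tl js))"

fun block_row :: "tensor list \<Rightarrow> tensor" where
  "block_row [] = undefined"
| "block_row [A] = A"
| "block_row (A # B # As) = join_last A (block_row (B # As))"

fun block_col :: "tensor list \<Rightarrow> tensor" where
  "block_col [] = undefined"
| "block_col [A] = A"
| "block_col (A # B # As) = join_first A (block_col (B # As))"

text \<open>The block tensor given by the list of its block rows.\<close>

definition block_tensor :: "tensor list list \<Rightarrow> tensor" where
  "block_tensor Bs = block_col (map block_row Bs)"


section \<open>Matricizations and the TT variety\<close>

text \<open>The \<open>p\<close>-th multi-index of shape \<open>ns\<close> in lexicographic order.\<close>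

fun lex_index :: "nat list \<Rightarrow> nat \<Rightarrow> nat list" where
  "lex_index [] p = []"
| "lex_index (n # ns) p = (p div prod_list ns) # lex_index ns (p mod prod_list ns)"

definition matricize :: "nat \<Rightarrow> tensor \<Rightarrow> real mat" where
  "matricize i A =
     mat (prod_list (take i (dims A))) (prod_list (drop i (dims A)))
       (\<lambda>(r, c). entry A (lex_index (take i (dims A)) r @ lex_index (drop i (dims A)) c))"

definition left_mat :: "tensor \<Rightarrow> real mat" where
  "left_mat A = matricize 1 A"

definition right_mat :: "tensor \<Rightarrow> real mat" where
  "right_mat A = matricize (length (dims A) - 1) A"

definition mat_rank :: "real mat \<Rightarrow> nat" where
  "mat_rank M = vec_space.rank (dim_row M) M"

definition tt_variety :: "nat list \<Rightarrow> (nat \<Rightarrow> nat) \<Rightarrow> tensor set" where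
  "tt_variety ns r =
     {A \<in> tensors ns. \<forall>i\<in>{1..<length ns}. mat_rank (matricize i A) \<le> r i}"

definition tt_manifold :: "nat list \<Rightarrow> (nat \<Rightarrow> nat) \<Rightarrow> tensor set" where
  "tt_manifold ns r =
     {A \<in> tensors ns. \<forall>i\<in>{1..<length ns}. mat_rank (matricize i A) = r i}"


section \<open>The tangent cone\<close>

text \<open>
  Convergence is taken in the product topology of \<open>nat list \<Rightarrow> real\<close>. For tensors of one
  fixed shape only finitely many coordinates are not constantly 0, so this is convergence in
  the Euclidean norm.
\<close>

definition tangent_cone :: "tensor set \<Rightarrow> tensor \<Rightarrow> tensor set" where
  "tangent_cone M A =
     {\<xi> \<in> tensors (dims A).
        \<exists>(x :: nat \<Rightarrow> tensor) (a :: nat \<Rightarrow> real).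
          (\<forall>n. x n \<in> M) \<and> (\<forall>n. a n > 0) \<and>
          (\<lambda>n. entry (x n)) \<longlonglongrightarrow> entry A \<and>
          (\<lambda>n js. a n * (entry (x n) js - entry A js)) \<longlonglongrightarrow> entry \<xi>}"


section \<open>Singular points of real algebraic varieties\<close>

text \<open>
  Varieties are sets of points \<open>'i \<Rightarrow> real\<close>. The index type may be infinite: if all points
  of \<open>V\<close> vanish outside a finite index set \<open>I\<close>, then so do all vectors of the Zariski tangent
  space (the remaining coordinate functions vanish on \<open>V\<close>) and all subvarieties of \<open>V\<close>, and
  the notions below are those for \<open>V\<close> as a subset of the coordinate space indexed by \<open>I\<close>.
\<close>

inductive_set poly_functions :: "(('i \<Rightarrow> real) \<Rightarrow> real) set" where
  const: "(\<lambda>_. c) \<in> poly_functions"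
| coord: "(\<lambda>x. x i) \<in> poly_functions"
| add: "p \<in> poly_functions \<Longrightarrow> q \<in> poly_functions \<Longrightarrow> (\<lambda>x. p x + q x) \<in> poly_functions"
| mult: "p \<in> poly_functions \<Longrightarrow> q \<in> poly_functions \<Longrightarrow> (\<lambda>x. p x * q x) \<in> poly_functions"

definition zariski_closed :: "('i \<Rightarrow> real) set \<Rightarrow> bool" where
  "zariski_closed Z \<longleftrightarrow> (\<exists>S \<subseteq> poly_functions. Z = {x. \<forall>p\<in>S. p x = 0})"

definition irreducible_variety :: "('i \<Rightarrow> real) set \<Rightarrow> bool" where
  "irreducible_variety Z \<longleftrightarrow> zariski_closed Z \<and> Z \<noteq> {} \<and>
     (\<forall>Y1 Y2. zariski_closed Y1 \<and> zariski_closed Y2 \<and> Z = Y1 \<union> Y2 \<longrightarrow> Z = Y1 \<or> Z = Y2)"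

text \<open>
  The largest dimension of an irreducible subvariety \<open>C m\<close> of \<open>V\<close> through \<open>x\<close>, where dimension
  is the length of chains of irreducible subvarieties. If \<open>V\<close> is irreducible, this is the
  dimension of \<open>V\<close>.
\<close>

definition variety_dim_at :: "('i \<Rightarrow> real) set \<Rightarrow> ('i \<Rightarrow> real) \<Rightarrow> nat" where
  "variety_dim_at V x = Sup {m. \<exists>C :: nat \<Rightarrow> ('i \<Rightarrow> real) set.
     (\<forall>j\<le>m. irreducible_variety (C j)) \<and> (\<forall>j<m. C j \<subset> C (Suc j)) \<and> x \<in> C m \<and> C m \<subseteq> V}"

definition zariski_tangent_space :: "('i \<Rightarrow> real) set \<Rightarrow> ('i \<Rightarrow> real) \<Rightarrow> ('i \<Rightarrow> real) set" where
  "zariski_tangent_space V x =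
     {v. \<forall>p\<in>poly_functions. (\<forall>y\<in>V. p y = 0) \<longrightarrow>
           ((\<lambda>t. p (\<lambda>i. x i + t * v i)) has_real_derivative 0) (at 0)}"

abbreviation scale_fun :: "real \<Rightarrow> ('i \<Rightarrow> real) \<Rightarrow> 'i \<Rightarrow> real" where
  "scale_fun c f \<equiv> (\<lambda>i. c * f i)"

lemma vector_space_scale_fun:
  "vector_space (scale_fun :: real \<Rightarrow> ('i \<Rightarrow> real) \<Rightarrow> 'i \<Rightarrow> real)"
  by unfold_locales (auto simp: fun_eq_iff algebra_simps)

definition smooth_point :: "('i \<Rightarrow> real) set \<Rightarrow> ('i \<Rightarrow> real) \<Rightarrow> bool" where
  "smooth_point V x \<longleftrightarrow>
     x \<in> V \<and> vector_space.dim scale_fun (zariski_tangent_space V x) = variety_dim_at V x"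

definition singular_point :: "('i \<Rightarrow> real) set \<Rightarrow> ('i \<Rightarrow> real) \<Rightarrow> bool" where
  "singular_point V x \<longleftrightarrow> x \<in> V \<and> \<not> smooth_point V x"

end

theory Submission
  imports Defs
begin

text \<open>
  Write \<open>L\<close> for the product of the first \<open>i\<close> cores (orthonormal columns) and \<open>R\<close> for the product
  of the others (independent rows, as \<open>A\<close> has rank \<open>k i\<close>), so that the \<open>i\<close>-th matricization of \<open>A\<close>
  is \<open>L R\<close>. If \<open>x m\<close> tends to \<open>A\<close> and \<open>t m (x m - A)\<close> to \<open>\<xi>\<close>, the orthogonal projections \<open>P m\<close> onto
  the column spaces of \<open>x m\<close> have rank at most \<open>k i + s i\<close> and subconverge to a projection \<open>P\<close> with
  \<open>P L = L\<close>. With \<open>Q\<close> the projection onto the orthogonal complement of the rows of \<open>R\<close> we have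
  \<open>A Q = 0\<close>, hence \<open>(1 - P m) t m (x m - A) Q = 0\<close> and in the limit \<open>(1 - P) \<xi> Q = 0\<close>. Here
  \<open>P = L L\<^sup>T + W W\<^sup>T\<close> for some \<open>W\<close> with \<open>s i\<close> columns orthogonal to \<open>L\<close>.

  Given such \<open>L\<close>, \<open>W\<close>, \<open>Q\<close> for every \<open>i\<close>, the three block rows of the product of the block
  tensors \<open>i + 1, \<dots>, d\<close> are \<open>L\<^sup>T \<xi>\<close>, \<open>W\<^sup>T \<xi> Q\<close> and \<open>R\<close>. The recursions linking these for
  \<open>i\<close> and \<open>i + 1\<close> define the blocks, and the case \<open>i = 0\<close> is the claim.
\<close>

section \<open>Orthogonal projections on a finite index set\<close>

text \<open>Projections are kernels on an arbitrary index set instead of matrices, because rows and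
  columns are indexed by multi-indices later. Values outside \<open>I\<close> are left
  unconstrained.\<close>

definition orth_proj :: "'a set \<Rightarrow> ('a \<Rightarrow> 'a \<Rightarrow> real) \<Rightarrow> bool" where
  "orth_proj I P \<longleftrightarrow> (\<forall>a\<in>I. \<forall>b\<in>I. P a b = P b a) \<and>
     (\<forall>a\<in>I. \<forall>b\<in>I. (\<Sum>c\<in>I. P a c * P c b) = P a b)"

lemma orth_proj_sym: "orth_proj I P \<Longrightarrow> a \<in> I \<Longrightarrow> b \<in> I \<Longrightarrow> P a b = P b a"
  by (auto simp: orth_proj_def)

lemma orth_proj_idem: "orth_proj I P \<Longrightarrow> a \<in> I \<Longrightarrow> b \<in> I \<Longrightarrow> (\<Sum>c\<in>I. P a c * P c b) = P a b"
  unfolding orth_proj_def by blast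

text \<open>By idempotence and symmetry a diagonal entry is the squared norm of its column.
  Nonnegativity, boundedness and the trace criterion for vanishing all rest on this.\<close>

lemma orth_proj_diag:
  assumes "orth_proj I P" "b \<in> I"
  shows "P b b = (\<Sum>a\<in>I. (P a b)\<^sup>2)"
proof -
  have "P b b = (\<Sum>a\<in>I. P b a * P a b)" using assms by (simp add: orth_proj_idem)
  also have "\<dots> = (\<Sum>a\<in>I. (P a b)\<^sup>2)"
    using assms by (intro sum.cong refl) (simp add: orth_proj_sym[of I P b] power2_eq_square)
  finally show ?thesis .
qed

lemma orth_proj_diag_nonneg:
  assumes "orth_proj I P" "b \<in> I"
  shows "0 \<le> P b b"
  using orth_proj_diag[OF assms] by (simp add: sum_nonneg)

text \<open>This bound provides the compactness from which a convergent subsequence of projections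
  is extracted.\<close>

lemma orth_proj_abs_le_1:
  assumes "finite I" "orth_proj I P" "a \<in> I" "b \<in> I"
  shows "\<bar>P a b\<bar> \<le> 1"
proof -
  have sq: "(P a b)\<^sup>2 \<le> P b b" if "a \<in> I" "b \<in> I" for a b
    unfolding orth_proj_diag[OF assms(2) that(2)]
    by (rule member_le_sum[OF that(1), of "\<lambda>a. (P a b)\<^sup>2"]) (use assms in auto)
  \<comment> \<open>The diagonal entry dominates its own square, which is impossible for a number
    above 1.\<close>
  have "P b b \<le> 1"
    using sq[OF assms(4,4)] mult_strict_right_mono[of 1 "P b b" "P b b"]
    by (cases "P b b \<le> 1") (auto simp: power2_eq_square)
  then have "(P a b)\<^sup>2 \<le> 1" using sq[OF assms(3,4)] by linarith
  then show ?thesis by (simp add: abs_square_le_1)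
qed

text \<open>The trace of a projection is its rank. The trace is used throughout in place of the rank
  because it is continuous and so survives limits.\<close>

lemma orth_proj_eq_0:
  assumes "finite I" "orth_proj I P" "(\<Sum>b\<in>I. P b b) \<le> 0" "a \<in> I" "b \<in> I"
  shows "P a b = 0"
proof -
  have "(\<Sum>b\<in>I. P b b) = 0"
    using assms by (intro antisym sum_nonneg) (auto intro: orth_proj_diag_nonneg)
  then have "P b b = 0"
    using assms by (subst (asm) sum_nonneg_eq_0_iff) (auto intro: orth_proj_diag_nonneg)
  then have "(\<Sum>a\<in>I. (P a b)\<^sup>2) = 0" using orth_proj_diag[OF assms(2,5)] by simp
  then show ?thesis
    using assms by (subst (asm) sum_nonneg_eq_0_iff) auto
qed

text \<open>The equation for \<open>t\<close> is exactly what idempotence asks of the coefficient of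
  \<open>u u^T\<close>. Two instances occur: \<open>l = 0\<close>, \<open>t = 1\<close> adjoins a
  unit vector orthogonal to the range, and \<open>l = 1\<close>, \<open>t = -1\<close> removes one
  from the range.\<close>

lemma orth_proj_rank1_update:
  assumes P: "orth_proj I P" and fin: "finite I"
    and eig: "\<And>a. a \<in> I \<Longrightarrow> (\<Sum>b\<in>I. P a b * u b) = l * u a"
    and nrm: "(\<Sum>a\<in>I. u a * u a) = 1"
    and t: "2 * l * t + t * t = t"
  shows "orth_proj I (\<lambda>a b. P a b + t * (u a * u b))"
  unfolding orth_proj_def
proof (intro conjI ballI)
  fix a b assume ab: "a \<in> I" "b \<in> I"
  show "P a b + t * (u a * u b) = P b a + t * (u b * u a)"
    using orth_proj_sym[OF P ab] by simp
  have eig': "(\<Sum>c\<in>I. u c * P c b) = l * u b"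
    unfolding eig[OF ab(2), symmetric] using ab
    by (intro sum.cong refl) (simp add: orth_proj_sym[OF P])
  have "(\<Sum>c\<in>I. (P a c + t * (u a * u c)) * (P c b + t * (u c * u b))) =
     (\<Sum>c\<in>I. P a c * P c b + t * u b * (P a c * u c) + t * u a * (u c * P c b)
        + t * t * u a * u b * (u c * u c))"
    by (intro sum.cong refl) (simp add: algebra_simps)
  also have "\<dots> = P a b + (2 * l * t + t * t) * (u a * u b)"
    unfolding sum.distrib sum_distrib_left[symmetric] orth_proj_idem[OF P ab] eig[OF ab(1)] eig' nrm
    by (simp add: algebra_simps)
  finally show "(\<Sum>c\<in>I. (P a c + t * (u a * u c)) * (P c b + t * (u c * u b))) =
     P a b + t * (u a * u b)" unfolding t .
qed

text \<open>Gram-Schmidt: each new vector contributes its normalized component orthogonal to the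
  current range. The trace is only bounded by \<open>r\<close> since dependent vectors contribute
  nothing. \<open>N\<close> witnesses that the columns of \<open>P\<close> lie in the span of the
  \<open>f l\<close>.\<close>

lemma orth_proj_span:
  fixes f :: "nat \<Rightarrow> 'a \<Rightarrow> real"
  assumes fin: "finite I"
  shows "\<exists>P N. orth_proj I P \<and> (\<Sum>a\<in>I. P a a) \<le> real r \<and>
     (\<forall>l<r. \<forall>a\<in>I. (\<Sum>b\<in>I. P a b * f l b) = f l a) \<and>
     (\<forall>a\<in>I. \<forall>b\<in>I. P a b = (\<Sum>l<r. f l a * N l b))"
proof (induction r)
  case 0
  show ?case
    by (rule exI[of _ "\<lambda>_ _. 0"]) (auto simp: orth_proj_def)
next
  case (Suc r)
  then obtain P N where P: "orth_proj I P" and tr: "(\<Sum>a\<in>I. P a a) \<le> real r"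
    and fixp: "\<And>l a. l < r \<Longrightarrow> a \<in> I \<Longrightarrow> (\<Sum>b\<in>I. P a b * f l b) = f l a"
    and N: "\<And>a b. a \<in> I \<Longrightarrow> b \<in> I \<Longrightarrow> P a b = (\<Sum>l<r. f l a * N l b)" by blast
  \<comment> \<open>\<open>g\<close> is the component of \<open>f r\<close> orthogonal to the range
    of \<open>P\<close>, and \<open>s\<close> is its squared norm; \<open>s = 0\<close> means that
    \<open>f r\<close> already lies in the range.\<close>
  define g where "g a = f r a - (\<Sum>b\<in>I. P a b * f r b)" for a
  define s where "s = (\<Sum>a\<in>I. g a * g a)"
  have s0: "s \<ge> 0" unfolding s_def by (simp add: sum_nonneg)
  have Pg: "(\<Sum>b\<in>I. P a b * g b) = 0" if "a \<in> I" for a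
  proof -
    have "(\<Sum>b\<in>I. P a b * (\<Sum>c\<in>I. P b c * f r c)) = (\<Sum>c\<in>I. (\<Sum>b\<in>I. P a b * P b c) * f r c)"
      by (simp add: sum_distrib_left sum_distrib_right mult.assoc) (rule sum.swap)
    also have "\<dots> = (\<Sum>c\<in>I. P a c * f r c)"
      using that by (intro sum.cong refl) (simp add: orth_proj_idem[OF P])
    finally show ?thesis unfolding g_def by (simp add: right_diff_distrib sum_subtractf)
  qed
  show ?case
  proof (cases "s = 0")
    case True
    then have g0: "g a = 0" if "a \<in> I" for a
      using that fin unfolding s_def by (subst (asm) sum_nonneg_eq_0_iff) auto
    have "(\<Sum>b\<in>I. P a b * f l b) = f l a" if "l < Suc r" "a \<in> I" for l a
      using fixp[of l a] g0[of a] that by (cases "l = r") (auto simp: g_def)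
    then show ?thesis using P tr N
      by (intro exI[of _ P] exI[of _ "\<lambda>l b. if l < r then N l b else 0"]) auto
  next
    case False
    with s0 have s: "s > 0" by simp
    define u where "u a = g a / sqrt s" for a
    have uu: "u a * u b = g a * g b / s" for a b using s by (simp add: u_def)
    have nrm: "(\<Sum>a\<in>I. u a * u a) = 1"
      unfolding uu sum_divide_distrib[symmetric] s_def[symmetric] using s by simp
    have Pu: "(\<Sum>b\<in>I. P a b * u b) = 0 * u a" if "a \<in> I" for a
      using Pg[OF that] by (simp add: u_def sum_divide_distrib[symmetric])
    define Q where "Q a b = P a b + 1 * (u a * u b)" for a b
    have Q: "orth_proj I Q"
      unfolding Q_def by (rule orth_proj_rank1_update[OF P fin Pu nrm]) auto
    have trQ: "(\<Sum>a\<in>I. Q a a) \<le> real (Suc r)"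
      using tr nrm by (simp add: Q_def sum.distrib)
    \<comment> \<open>\<open>g\<close> is orthogonal to every vector of the form \<open>P f\<close>,
      because \<open>P\<close> is symmetric and kills \<open>g\<close>.\<close>
    have Pf: "(\<Sum>b\<in>I. g b * (\<Sum>c\<in>I. P b c * f l c)) = 0" for l
    proof -
      have "(\<Sum>b\<in>I. g b * (\<Sum>c\<in>I. P b c * f l c)) = (\<Sum>c\<in>I. (\<Sum>b\<in>I. P c b * g b) * f l c)"
        unfolding sum_distrib_left sum_distrib_right
        by (subst sum.swap) (intro sum.cong refl, simp add: orth_proj_sym[OF P])
      then show ?thesis using Pg by simp
    qed
    have gf: "(\<Sum>b\<in>I. g b * f l b) = (if l = r then s else 0)" if "l \<le> r" for l
    proof (cases "l = r")
      case True
      have "(\<Sum>b\<in>I. g b * f r b) = (\<Sum>b\<in>I. g b * g b) + (\<Sum>b\<in>I. g b * (\<Sum>c\<in>I. P b c * f r c))"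
        unfolding sum.distrib[symmetric]
        by (intro sum.cong refl) (simp add: g_def algebra_simps)
      then show ?thesis using True Pf by (simp add: s_def)
    next
      case False
      then have "(\<Sum>b\<in>I. g b * f l b) = (\<Sum>b\<in>I. g b * (\<Sum>c\<in>I. P b c * f l c))"
        using that fixp by (intro sum.cong refl) simp
      then show ?thesis using False Pf by simp
    qed
    have Qf: "(\<Sum>b\<in>I. Q a b * f l b) = (\<Sum>b\<in>I. P a b * f l b) + g a * (\<Sum>b\<in>I. g b * f l b) / s" for a l
      unfolding Q_def uu
      by (simp add: sum.distrib sum_distrib_left sum_divide_distrib distrib_right mult.assoc)
    have fixQ: "(\<Sum>b\<in>I. Q a b * f l b) = f l a" if "l < Suc r" "a \<in> I" for l a
    proof (cases "l = r")
      case True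
      then show ?thesis using s unfolding Qf by (simp add: gf) (simp add: g_def)
    next
      case False
      then show ?thesis using that fixp[of l a] unfolding Qf by (simp add: gf)
    qed
    \<comment> \<open>The coefficients come from inserting \<open>g = f r - P (f r)\<close> into the
      left factor of the update \<open>g g^T / s\<close> and expanding \<open>P (f r)\<close> by
      \<open>N\<close>.\<close>
    define N' where "N' l b = (if l < r then N l b - (\<Sum>c\<in>I. N l c * f r c) * g b / s else g b / s)" for l b
    have NQ: "Q a b = (\<Sum>l<Suc r. f l a * N' l b)" if "a \<in> I" "b \<in> I" for a b
    proof -
      have "(\<Sum>c\<in>I. P a c * f r c) = (\<Sum>l<r. f l a * (\<Sum>c\<in>I. N l c * f r c))"
      proof -
        have "(\<Sum>c\<in>I. P a c * f r c) = (\<Sum>c\<in>I. \<Sum>l<r. f l a * N l c * f r c)"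
          using that by (intro sum.cong refl) (simp add: N sum_distrib_right)
        also have "\<dots> = (\<Sum>l<r. \<Sum>c\<in>I. f l a * N l c * f r c)" by (rule sum.swap)
        finally show ?thesis by (simp add: sum_distrib_left mult.assoc)
      qed
      then have g: "g a = f r a - (\<Sum>l<r. f l a * (\<Sum>c\<in>I. N l c * f r c))" by (simp add: g_def)
      define S where "S l = (\<Sum>c\<in>I. N l c * f r c)" for l
      have "(\<Sum>l<Suc r. f l a * N' l b) =
        (\<Sum>l<r. f l a * N l b - (f l a * S l) * (g b / s)) + f r a * (g b / s)"
        by (simp add: N'_def S_def[symmetric] right_diff_distrib mult.assoc)
      also have "\<dots> =
        (\<Sum>l<r. f l a * N l b) - (\<Sum>l<r. f l a * S l) * (g b / s) + f r a * (g b / s)"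
        by (simp only: sum_subtractf sum_distrib_right)
      also have "\<dots> = P a b + g a * (g b / s)"
        unfolding N[OF that, symmetric] g S_def[symmetric] by (simp only: left_diff_distrib right_diff_distrib add_diff_eq diff_add_eq)
      finally show ?thesis by (simp add: Q_def uu)
    qed
    show ?thesis using Q trQ fixQ NQ by blast
  qed
qed

text \<open>Deflation: a normalized nonzero column of \<open>P\<close> is a unit vector in its
  range, and removing it lowers the trace by 1. Once the trace is exhausted the remaining
  \<open>u l\<close> are zero, so exactly \<open>r\<close> vectors can always be listed.\<close>

lemma orth_proj_decompose:
  assumes fin: "finite I" and "orth_proj I P" "(\<Sum>a\<in>I. P a a) \<le> real r"
  shows "\<exists>u :: nat \<Rightarrow> 'a \<Rightarrow> real.
     (\<forall>a\<in>I. \<forall>b\<in>I. P a b = (\<Sum>l<r. u l a * u l b)) \<and>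
     (\<forall>l<r. \<forall>a\<in>I. (\<Sum>b\<in>I. P a b * u l b) = u l a)"
  using assms(2,3)
proof (induction r arbitrary: P)
  case 0
  then have tr: "(\<Sum>a\<in>I. P a a) \<le> 0" by simp
  show ?case using orth_proj_eq_0[OF fin 0(1) tr] by simp
next
  case (Suc r)
  show ?case
  proof (cases "(\<Sum>b\<in>I. P b b) \<le> 0")
    case True
    then show ?thesis using orth_proj_eq_0[OF fin Suc.prems(1) True] by (intro exI[of _ "\<lambda>_ _. 0"]) simp
  next
    case False
    have "\<exists>c\<in>I. \<not> P c c \<le> 0"
    proof (rule ccontr)
      assume "\<not> (\<exists>c\<in>I. \<not> P c c \<le> 0)"
      then have "P c c \<le> 0" if "c \<in> I" for c using that by simp
      then have "(\<Sum>b\<in>I. P b b) \<le> 0" by (rule sum_nonpos)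
      with False show False by contradiction
    qed
    then obtain c where "c \<in> I" "\<not> P c c \<le> 0" by (rule bexE)
    then have c: "c \<in> I" "P c c > 0" by simp_all
    \<comment> \<open>Column \<open>c\<close> has squared norm \<open>P c c\<close> by
      \<open>orth_proj_diag\<close>, hence this normalization.\<close>
    define u where "u a = P a c / sqrt (P c c)" for a
    have uu: "u a * u b = P a c * P b c / P c c" for a b using c by (simp add: u_def)
    have nrm: "(\<Sum>a\<in>I. u a * u a) = 1"
      unfolding uu sum_divide_distrib[symmetric]
      using orth_proj_diag[OF Suc.prems(1) c(1)] c by (simp add: power2_eq_square)
    have Pu: "(\<Sum>b\<in>I. P a b * u b) = 1 * u a" if "a \<in> I" for a
      using orth_proj_idem[OF Suc.prems(1) that c(1)] by (simp add: u_def sum_divide_distrib[symmetric])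
    define Q where "Q a b = P a b + -1 * (u a * u b)" for a b
    have Q: "orth_proj I Q"
      unfolding Q_def by (rule orth_proj_rank1_update[OF Suc.prems(1) fin Pu nrm]) auto
    have "(\<Sum>a\<in>I. Q a a) = (\<Sum>a\<in>I. P a a) - 1"
      using nrm by (simp add: Q_def sum_subtractf)
    then have "(\<Sum>a\<in>I. Q a a) \<le> real r" using Suc.prems(2) by simp
    then obtain v :: "nat \<Rightarrow> 'a \<Rightarrow> real" where
      "(\<forall>a\<in>I. \<forall>b\<in>I. Q a b = (\<Sum>l<r. v l a * v l b)) \<and>
       (\<forall>l<r. \<forall>a\<in>I. (\<Sum>b\<in>I. Q a b * v l b) = v l a)"
      using Suc.IH[OF Q] by (elim meta_impE exE)
    note v' = conjunct1[OF this] conjunct2[OF this]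
    have v: "\<And>a b. a \<in> I \<Longrightarrow> b \<in> I \<Longrightarrow> Q a b = (\<Sum>l<r. v l a * v l b)"
         "\<And>l a. l < r \<Longrightarrow> a \<in> I \<Longrightarrow> (\<Sum>b\<in>I. Q a b * v l b) = v l a"
      by (rule v'(1)[rule_format], assumption+) (rule v'(2)[rule_format])
    \<comment> \<open>The vectors \<open>v l\<close> are fixed by \<open>Q\<close>, and
      \<open>P Q = Q\<close>, so they are fixed by \<open>P\<close> as well.\<close>
    have Pv: "(\<Sum>b\<in>I. P a b * v l b) = v l a" if l: "l < r" and a: "a \<in> I" for l a
    proof -
      have PQ: "(\<Sum>c\<in>I. P a c * Q c b) = Q a b" if b: "b \<in> I" for b
      proof -
        have "(\<Sum>c\<in>I. P a c * Q c b) = (\<Sum>c\<in>I. P a c * P c b) - (\<Sum>c\<in>I. P a c * u c) * u b"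
          by (simp add: Q_def right_diff_distrib sum_subtractf sum_distrib_right mult.assoc)
        then show ?thesis using orth_proj_idem[OF Suc.prems(1) a b] Pu[OF a] by (simp add: Q_def)
      qed
      have "(\<Sum>c\<in>I. P a c * v l c) = (\<Sum>c\<in>I. P a c * (\<Sum>b\<in>I. Q c b * v l b))"
        using v(2)[OF l] by (intro sum.cong refl) simp
      also have "\<dots> = (\<Sum>b\<in>I. (\<Sum>c\<in>I. P a c * Q c b) * v l b)"
        by (simp add: sum_distrib_left sum_distrib_right mult.assoc) (rule sum.swap)
      also have "\<dots> = v l a" using PQ v(2)[OF l a] by simp
      finally show ?thesis .
    qed
    have dec: "P a b = (\<Sum>l<r. v l a * v l b) + u a * u b" if "a \<in> I" "b \<in> I" for a b
      using v(1)[OF that] by (simp add: Q_def)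
    define w where "w l = (if l < r then v l else u)" for l
    have "P a b = (\<Sum>l<Suc r. w l a * w l b)" if "a \<in> I" "b \<in> I" for a b
      unfolding dec[OF that] by (simp add: w_def)
    note w1 = this
    have w2: "(\<Sum>b\<in>I. P a b * w l b) = w l a" if "l < Suc r" "a \<in> I" for l a
    proof (cases "l < r")
      case True
      then show ?thesis unfolding w_def using Pv[OF True that(2)] by (simp only: if_True simp_thms)
    next
      case False
      then show ?thesis unfolding w_def using Pu[OF that(2)] by (simp only: if_False simp_thms mult_1)
    qed
    show ?thesis
      by (rule exI[of _ w], rule conjI) (intro ballI, erule w1, assumption, intro allI impI ballI, erule w2, assumption)
  qed
qed

text \<open>The columns of \<open>L\<close> are removed one at a time by rank one updates, each
  being a unit vector in the range that is left. With trace at most \<open>k + s\<close> before, at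
  most \<open>s\<close> remains.\<close>

lemma orth_proj_diff_orthonormal:
  fixes L :: "'a \<Rightarrow> nat \<Rightarrow> real"
  assumes fin: "finite I" and P: "orth_proj I P"
    and ort: "\<And>p q. p < k \<Longrightarrow> q < k \<Longrightarrow> (\<Sum>a\<in>I. L a p * L a q) = (if p = q then 1 else 0)"
    and fix1: "\<And>p a. p < k \<Longrightarrow> a \<in> I \<Longrightarrow> (\<Sum>b\<in>I. P a b * L b p) = L a p"
  shows "orth_proj I (\<lambda>a b. P a b - (\<Sum>p<k. L a p * L b p))"
    and "(\<Sum>a\<in>I. P a a - (\<Sum>p<k. L a p * L a p)) = (\<Sum>a\<in>I. P a a) - real k"
    and "\<And>q a. q < k \<Longrightarrow> a \<in> I \<Longrightarrow> (\<Sum>b\<in>I. (P a b - (\<Sum>p<k. L a p * L b p)) * L b q) = 0"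
proof -
  \<comment> \<open>After the first \<open>j\<close> columns are removed, these are annihilated
    while the later ones are still fixed. So column \<open>j\<close> is again an eigenvector for the
    eigenvalue 1.\<close>
  have A: "(\<Sum>b\<in>I. (P a b - (\<Sum>p<j. L a p * L b p)) * L b q) = (if q < j then 0 else L a q)"
    if "j \<le> k" "q < k" "a \<in> I" for j q a
  proof -
    have "(\<Sum>b\<in>I. (\<Sum>p<j. L a p * L b p) * L b q) = (\<Sum>p<j. L a p * (\<Sum>b\<in>I. L b p * L b q))"
      by (simp add: sum_distrib_left sum_distrib_right mult.assoc) (rule sum.swap)
    also have "\<dots> = (\<Sum>p<j. L a p * (if p = q then 1 else 0))"
      using that by (intro sum.cong refl) (simp add: ort)
    also have "\<dots> = (\<Sum>p<j. if p = q then L a p else 0)"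
      by (intro sum.cong refl) simp
    also have "\<dots> = (if q < j then L a q else 0)" by (simp add: sum.delta)
    finally show ?thesis using fix1[OF that(2,3)] by (simp add: left_diff_distrib sum_subtractf)
  qed
  have "orth_proj I (\<lambda>a b. P a b - (\<Sum>p<j. L a p * L b p))" if "j \<le> k" for j
    using that
  proof (induction j)
    case 0
    then show ?case using P by simp
  next
    case (Suc j)
    have "orth_proj I (\<lambda>a b. (P a b - (\<Sum>p<j. L a p * L b p)) + -1 * (L a j * L b j))"
      by (rule orth_proj_rank1_update[where l = 1])
        (use Suc fin in \<open>auto simp: ort A\<close>)
    then show ?case by (simp add: algebra_simps)
  qed
  then show "orth_proj I (\<lambda>a b. P a b - (\<Sum>p<k. L a p * L b p))" by simp
  show "(\<Sum>a\<in>I. P a a - (\<Sum>p<k. L a p * L a p)) = (\<Sum>a\<in>I. P a a) - real k"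
    unfolding sum_subtractf sum.swap[of _ "{..<k}"] by (simp add: ort)
  show "(\<Sum>b\<in>I. (P a b - (\<Sum>p<k. L a p * L b p)) * L b q) = 0" if "q < k" "a \<in> I" for q a
    using A[of k] that by simp
qed

text \<open>Bolzano-Weierstrass is applied once per index, each time inside the subsequence found
  before.\<close>

lemma bounded_family_convergent_subseq:
  fixes f :: "'k \<Rightarrow> nat \<Rightarrow> real"
  assumes "finite K" "\<And>i. i \<in> K \<Longrightarrow> \<forall>n. \<bar>f i n\<bar> \<le> B i"
  shows "\<exists>r. strict_mono (r :: nat \<Rightarrow> nat) \<and> (\<forall>i\<in>K. convergent (f i \<circ> r))"
  using assms
proof (induction K rule: finite_induct)
  case empty
  then show ?case by (intro exI[of _ id]) (auto simp: strict_mono_def)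
next
  case (insert x F)
  have "\<exists>r. strict_mono (r :: nat \<Rightarrow> nat) \<and> (\<forall>i\<in>F. convergent (f i \<circ> r))"
    by (rule insert.IH) (use insert.prems in auto)
  then obtain r where r: "strict_mono r" "\<forall>i\<in>F. convergent (f i \<circ> r)" by blast
  have "bounded (range (f x \<circ> r))"
    unfolding bounded_iff using insert.prems[of x] by (auto intro!: exI[of _ "B x"])
  from bounded_imp_convergent_subsequence[OF this]
  obtain l q where q: "strict_mono q" "((f x \<circ> r) \<circ> q) \<longlonglongrightarrow> l" by blast
  have "convergent (f i \<circ> (r \<circ> q))" if "i \<in> insert x F" for i
  proof (cases "i = x")
    case True
    then show ?thesis using q by (auto simp: convergent_def o_assoc)
  next
    case False
    then have "convergent (f i \<circ> r)" using r that by auto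
    then have "convergent ((f i \<circ> r) \<circ> q)" using q(1) by (rule convergent_subseq_convergent)
    then show ?thesis by (simp add: o_assoc)
  qed
  then show ?case using strict_mono_o[OF r(1) q(1)] by blast
qed

section \<open>Matrix rank and matricizations\<close>

text \<open>A sum of \<open>r\<close> products of a column and a row; each has rank at most 1 and
  rank is subadditive.\<close>

lemma mat_rank_le_of_factorization:
  fixes f :: "nat \<Rightarrow> nat \<Rightarrow> real" and g :: "nat \<Rightarrow> nat \<Rightarrow> real"
  shows "mat_rank (mat m n (\<lambda>(i, j). \<Sum>l<r. f l i * g l j)) \<le> r"
proof (induction r)
  case 0
  have "mat m n (\<lambda>(i, j). \<Sum>l<0. f l i * g l j) = 0\<^sub>m m n" by (intro eq_matI) auto
  then show ?case unfolding mat_rank_def by (simp only: vec_space.rank_0I dim_row_mat index_zero_mat le_refl)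
next
  case (Suc r)
  let ?A = "\<lambda>r. mat m n (\<lambda>(i, j). \<Sum>l<r. f l i * g l j)"
  let ?B = "mat m n (\<lambda>(i, j). f r i * g r j)"
  have "?A (Suc r) = ?A r + ?B" by (intro eq_matI) auto
  moreover have "vec_space.rank m (?A r + ?B) \<le> vec_space.rank m (?A r) + vec_space.rank m ?B"
    by (rule vec_space.rank_subadditive) auto
  moreover have "vec_space.rank m ?B \<le> 1"
    by (rule vec_space.rank_le_1_product_entries[where f = "f r" and g = "g r"]) auto
  ultimately show ?case using Suc by (simp add: mat_rank_def)
qed

text \<open>A maximal independent set of columns has as many elements as the rank and spans all
  columns; the coefficients of the columns in it give \<open>g\<close>.\<close>

lemma mat_rank_factorization:
  fixes M :: "real mat"
  shows "\<exists>f g. \<forall>i < dim_row M. \<forall>j < dim_col M. M $$ (i, j) = (\<Sum>l<mat_rank M. f l i * g l j)"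
proof -
  define m where "m = dim_row M"
  interpret vec_space "TYPE(real)" m .
  have M: "M \<in> carrier_mat m (dim_col M)" by (simp add: m_def)
  have "lin_indpt {}"
    by (auto simp: lin_dep_def)
  then obtain S where fS: "finite S" and S: "maximal S (\<lambda>T. T \<subseteq> set (cols M) \<and> lin_indpt T)"
    using maximal_exists_superset[of "set (cols M)" "\<lambda>T. T \<subseteq> set (cols M) \<and> lin_indpt T" "{}"]
    by auto
  have r: "mat_rank M = card S"
    unfolding mat_rank_def m_def[symmetric] by (rule rank_card_indpt[OF M S])
  have cM: "set (cols M) \<subseteq> carrier_vec m" using cols_dim[of M] by (simp add: m_def)
  have SM: "S \<subseteq> set (cols M)" and li: "lin_indpt S" using S by (auto simp: maximal_def)
  have Sc: "S \<subseteq> carrier_vec m" using SM cM by blast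
  \<comment> \<open>A column outside the span could be added to \<open>S\<close>, against
    maximality.\<close>
  have spn: "c \<in> span S" if c: "c \<in> set (cols M)" for c
  proof (rule ccontr)
    assume n: "c \<notin> span S"
    then have "c \<notin> S" using in_own_span[OF Sc] by blast
    have "lin_indpt (insert c S)"
      using lin_dep_iff_in_span[OF Sc li _ \<open>c \<notin> S\<close>] n c cM by auto
    then have "insert c S = S" using S c SM unfolding maximal_def by blast
    then show False using \<open>c \<notin> S\<close> by blast
  qed
  obtain h where h: "bij_betw h {..<card S} S"
    using ex_bij_betw_nat_finite[OF fS] by (auto simp: atLeast0LessThan)
  have "\<exists>a. col M j = lincomb a S" if "j < dim_col M" for j
  proof -
    have "col M j \<in> span S" using that by (intro spn) (auto simp: cols_def)
    from finite_in_span[OF fS Sc this] obtain a where "lincomb a S = col M j" by auto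
    from this[symmetric] show ?thesis by (rule exI[of _ a])
  qed
  then have "\<forall>j. \<exists>a. j < dim_col M \<longrightarrow> col M j = lincomb a S" by blast
  from choice[OF this] obtain a where a: "\<And>j. j < dim_col M \<Longrightarrow> col M j = lincomb (a j) S"
    by blast
  have "M $$ (i, j) = (\<Sum>l<card S. h l $ i * a j (h l))" if ij: "i < dim_row M" "j < dim_col M" for i j
  proof -
    have "M $$ (i, j) = lincomb (a j) S $ i" using ij by (simp add: a[OF ij(2), symmetric])
    also have "\<dots> = (\<Sum>x\<in>S. x $ i * a j x)"
      using ij Sc by (subst lincomb_index) (auto simp: m_def mult.commute)
    also have "\<dots> = (\<Sum>l<card S. h l $ i * a j (h l))"
      by (rule sum.reindex_bij_betw[OF h, symmetric])
    finally show ?thesis .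
  qed
  then show ?thesis unfolding r
    by (intro exI[of _ "\<lambda>l i. h l $ i"] exI[of _ "\<lambda>l j. a j (h l)"] allI impI)
qed

section \<open>Multi-indices and their lexicographic enumeration\<close>

lemma multi_indices_Nil [simp]: "multi_indices [] = {[]}"
  by (auto simp: multi_indices_def)

lemma Cons_in_multi_indices [simp]:
  "j # js \<in> multi_indices (n # ns) \<longleftrightarrow> j < n \<and> js \<in> multi_indices ns"
  by (simp add: multi_indices_def)

lemma in_multi_indices_Cons:
  "js \<in> multi_indices (n # ns) \<longleftrightarrow> (\<exists>j js'. js = j # js' \<and> j < n \<and> js' \<in> multi_indices ns)"
  by (auto simp: multi_indices_def list_all2_Cons2)

lemma multi_indices_length: "js \<in> multi_indices ns \<Longrightarrow> length js = length ns"
  by (auto simp: multi_indices_def dest: list_all2_lengthD)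

lemma append_in_multi_indices [simp]:
  "length a = length ns \<Longrightarrow> a @ b \<in> multi_indices (ns @ ms) \<longleftrightarrow> a \<in> multi_indices ns \<and> b \<in> multi_indices ms"
  by (simp add: multi_indices_def list_all2_append)

lemma multi_indices_Cons: "multi_indices (n # ns) = (\<lambda>(j, js). j # js) ` ({..<n} \<times> multi_indices ns)"
  by (auto simp: in_multi_indices_Cons)

lemma finite_multi_indices [simp]: "finite (multi_indices ns)"
  by (induction ns) (auto simp: multi_indices_Cons)

lemma sum_multi_indices_Cons:
  "(\<Sum>js\<in>multi_indices (n # ns). f js) = (\<Sum>j<n. \<Sum>js\<in>multi_indices ns. f (j # js))"
proof -
  have "(\<Sum>js\<in>multi_indices (n # ns). f js) = (\<Sum>(j, js)\<in>{..<n} \<times> multi_indices ns. f (j # js))"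
    unfolding multi_indices_Cons
    by (subst sum.reindex) (auto simp: inj_on_def case_prod_beta)
  then show ?thesis by (simp add: sum.cartesian_product)
qed

lemma sum_multi_indices_append:
  "(\<Sum>js\<in>multi_indices (ns @ ms). f js) = (\<Sum>a\<in>multi_indices ns. \<Sum>b\<in>multi_indices ms. f (a @ b))"
  by (induction ns arbitrary: f) (simp_all add: sum_multi_indices_Cons)

lemma sum_multi_indices_snoc:
  "(\<Sum>js\<in>multi_indices (ns @ [n]). f js) = (\<Sum>a\<in>multi_indices ns. \<Sum>j<n. f (a @ [j]))"
  by (simp add: sum_multi_indices_append sum_multi_indices_Cons)

text \<open>Mixed radix representation: quotient and remainder by the product of the remaining
  dimensions give the first digit and the number of the tail.\<close>

lemma bij_betw_lex_index: "bij_betw (lex_index ns) {..<prod_list ns} (multi_indices ns)"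
proof (induction ns)
  case Nil
  then show ?case by (simp add: bij_betw_def lessThan_Suc)
next
  case (Cons n ns)
  let ?M = "prod_list ns"
  have inj: "inj_on (lex_index ns) {..<?M}" and im: "lex_index ns ` {..<?M} = multi_indices ns"
    using Cons by (auto simp: bij_betw_def)
  show ?case unfolding bij_betw_def
  proof
    show "inj_on (lex_index (n # ns)) {..<prod_list (n # ns)}"
    proof (rule inj_onI)
      fix x y assume xy: "x \<in> {..<prod_list (n # ns)}" "y \<in> {..<prod_list (n # ns)}"
        and e: "lex_index (n # ns) x = lex_index (n # ns) y"
      \<comment> \<open>Dimensions may be 0, but then there is no \<open>x\<close> to consider. A
        positive \<open>?M\<close> is what puts the remainders into the range where the tail
        enumeration is injective.\<close>
      from xy have "0 < ?M" by (cases ?M) auto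
      then have "x mod ?M = y mod ?M" using e inj by (auto simp: inj_on_def)
      then show "x = y" using e by (metis div_mult_mod_eq lex_index.simps(2) list.inject)
    qed
    show "lex_index (n # ns) ` {..<prod_list (n # ns)} = multi_indices (n # ns)"
    proof (intro equalityI subsetI)
      fix js assume "js \<in> lex_index (n # ns) ` {..<prod_list (n # ns)}"
      then obtain x where x: "x < n * ?M" "js = lex_index (n # ns) x" by auto
      then have "0 < ?M" by (cases ?M) auto
      then have "lex_index ns (x mod ?M) \<in> multi_indices ns" using im by auto
      moreover have "x div ?M < n" using x by (simp add: less_mult_imp_div_less)
      ultimately show "js \<in> multi_indices (n # ns)" using x by simp
    next
      fix js assume "js \<in> multi_indices (n # ns)"
      then obtain j js' where js: "js = j # js'" "j < n" "js' \<in> multi_indices ns"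
        by (auto simp: in_multi_indices_Cons)
      then obtain x where x: "x < ?M" "js' = lex_index ns x" using im by auto
      have "j * ?M + x < n * ?M"
      proof -
        have "j * ?M + x < Suc j * ?M" using x by simp
        also have "\<dots> \<le> n * ?M" using js by (intro mult_right_mono) auto
        finally show ?thesis .
      qed
      moreover have "lex_index (n # ns) (j * ?M + x) = js"
      proof -
        have "(j * ?M + x) div ?M = j" using x by (intro div_nat_eqI) auto
        then show ?thesis using x js by simp
      qed
      ultimately show "js \<in> lex_index (n # ns) ` {..<prod_list (n # ns)}"
        by (intro image_eqI[of _ _ "j * ?M + x"]) auto
    qed
  qed
qed

lemma sum_lex_index: "(\<Sum>c<prod_list ns. f (lex_index ns c)) = (\<Sum>js\<in>multi_indices ns. f js)"
  by (rule sum.reindex_bij_betw[OF bij_betw_lex_index])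

lemma lex_index_in: "c < prod_list ns \<Longrightarrow> lex_index ns c \<in> multi_indices ns"
  using bij_betw_lex_index[of ns] by (auto simp: bij_betw_def)

lemma lex_index_surj:
  assumes "js \<in> multi_indices ns" obtains c where "c < prod_list ns" "js = lex_index ns c"
  using assms bij_betw_lex_index[of ns] by (auto simp: bij_betw_def)

section \<open>Rank of a matricization and factorizations over pairs of multi-indices\<close>

lemma matricize_append:
  assumes "dims A = ns @ ms" "i = length ns"
  shows "matricize i A = mat (prod_list ns) (prod_list ms)
    (\<lambda>(r, c). entry A (lex_index ns r @ lex_index ms c))"
  using assms by (simp add: matricize_def)

text \<open>Carries \<open>mat_rank_factorization\<close> from matrix positions to multi-indices.
  Only an upper bound \<open>r\<close> is assumed, so that the number of terms is the same for all
  tensors of a variety.\<close>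

lemma matricize_factorization:
  assumes A: "dims A = ns @ ms" and r: "mat_rank (matricize (length ns) A) \<le> r"
  shows "\<exists>f g. \<forall>a\<in>multi_indices ns. \<forall>b\<in>multi_indices ms. entry A (a @ b) = (\<Sum>l<r. f l a * g l b)"
proof -
  define M where "M = matricize (length ns) A"
  have M: "M = mat (prod_list ns) (prod_list ms) (\<lambda>(r, c). entry A (lex_index ns r @ lex_index ms c))"
    unfolding M_def using A by (intro matricize_append) auto
  define r0 where "r0 = mat_rank M"
  have dM: "dim_row M = prod_list ns" "dim_col M = prod_list ms" by (simp_all add: M)
  from mat_rank_factorization[of M, folded r0_def, unfolded dM] obtain f g where
    fg: "\<forall>i < prod_list ns. \<forall>j < prod_list ms. M $$ (i, j) = (\<Sum>l<r0. f l i * g l j)" by (elim exE)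
  have r0: "r0 \<le> r" using r by (simp add: r0_def M_def)
  let ?inv = "\<lambda>ns. the_inv_into {..<prod_list ns} (lex_index ns)"
  have inv: "?inv ns (lex_index ns i) = i" if "i < prod_list ns" for ns i
    using that bij_betw_lex_index[of ns] by (intro the_inv_into_f_f) (auto simp: bij_betw_def)
  \<comment> \<open>Terms from the true rank \<open>r0\<close> up to \<open>r\<close> are filled
    with zeros; the inverse of \<open>lex_index\<close> recovers the matrix row.\<close>
  define f' where "f' l a = (if l < r0 then f l (?inv ns a) else 0)" for l a
  have "entry A (a @ b) = (\<Sum>l<r. f' l a * g l (?inv ms b))"
    if ab: "a \<in> multi_indices ns" "b \<in> multi_indices ms" for a b
  proof -
    obtain i where i: "i < prod_list ns" "a = lex_index ns i" by (rule lex_index_surj[OF ab(1)])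
    obtain j where j: "j < prod_list ms" "b = lex_index ms j" by (rule lex_index_surj[OF ab(2)])
    have "(\<Sum>l<r. f' l a * g l (?inv ms b)) = (\<Sum>l<r0. f' l a * g l (?inv ms b))"
      using r0 by (intro sum.mono_neutral_right) (auto simp: f'_def)
    also have "\<dots> = (\<Sum>l<r0. f l i * g l j)"
      unfolding i(2) j(2) inv[OF j(1)] by (intro sum.cong refl) (simp add: f'_def inv[OF i(1)])
    also have "\<dots> = M $$ (i, j)" using fg i(1) j(1) by (simp only:)
    also have "\<dots> = entry A (a @ b)" using i j by (simp add: M)
    finally show ?thesis ..
  qed
  then show ?thesis
    by (intro exI[of _ f'] exI[of _ "\<lambda>l b. g l (?inv ms b)"] ballI)
qed

lemma matricize_rank_le:
  assumes A: "dims A = ns @ ms"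
    and f: "\<And>a b. a \<in> multi_indices ns \<Longrightarrow> b \<in> multi_indices ms \<Longrightarrow> entry A (a @ b) = (\<Sum>l<r. f l a * G l b)"
  shows "mat_rank (matricize (length ns) A) \<le> r"
proof -
  have "matricize (length ns) A = mat (prod_list ns) (prod_list ms)
    (\<lambda>(i, j). \<Sum>l<r. f l (lex_index ns i) * G l (lex_index ms j))"
    unfolding matricize_append[OF A refl] by (intro cong_mat refl) (simp add: f lex_index_in)
  then show ?thesis
    using mat_rank_le_of_factorization[where f = "\<lambda>l i. f l (lex_index ns i)" and
        g = "\<lambda>l j. G l (lex_index ms j)"] by (simp only:)
qed

text \<open>A relation between the rows of \<open>G\<close> that involves row \<open>p\<close> would
  allow that row to be eliminated, leaving a factorization with \<open>k - 1\<close> terms.\<close>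

lemma full_rank_factor_independent:
  assumes A: "dims A = ns @ ms"
    and f: "\<And>a b. a \<in> multi_indices ns \<Longrightarrow> b \<in> multi_indices ms \<Longrightarrow> entry A (a @ b) = (\<Sum>l<k. f l a * G l b)"
    and rk: "mat_rank (matricize (length ns) A) = k"
    and c: "\<And>b. b \<in> multi_indices ms \<Longrightarrow> (\<Sum>l<k. c l * G l b) = 0" and p: "p < k"
  shows "c p = 0"
proof (rule ccontr)
  assume cp: "c p \<noteq> 0"
  obtain h where h: "bij_betw h {..<k - 1} ({..<k} - {p})"
    using ex_bij_betw_nat_finite[of "{..<k} - {p}"] p by (auto simp: atLeast0LessThan)
  define g where "g l a = f l a - f p a * c l / c p" for l a
  have "entry A (a @ b) = (\<Sum>l<k - 1. g (h l) a * G (h l) b)"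
    if ab: "a \<in> multi_indices ns" "b \<in> multi_indices ms" for a b
  proof -
    have "(\<Sum>l<k - 1. g (h l) a * G (h l) b) = (\<Sum>l\<in>{..<k} - {p}. g l a * G l b)"
      by (rule sum.reindex_bij_betw[OF h])
    also have "\<dots> = (\<Sum>l<k. g l a * G l b)"
      using p cp by (intro sum.mono_neutral_left) (auto simp: g_def)
    also have "\<dots> = (\<Sum>l<k. f l a * G l b - f p a / c p * (c l * G l b))"
      by (intro sum.cong refl) (simp add: g_def left_diff_distrib)
    also have "\<dots> = (\<Sum>l<k. f l a * G l b)"
      unfolding sum_subtractf sum_distrib_left[symmetric] c[OF ab(2)] by simp
    finally show ?thesis using f[OF ab] by simp
  qed
  then have "mat_rank (matricize (length ns) A) \<le> k - 1" by (rule matricize_rank_le[OF A])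
  then show False using rk p by simp
qed

section \<open>Unfoldings with respect to the last and the first index\<close>

lemma right_mat_snoc:
  assumes "dims A = ns @ [p]"
  shows "right_mat A = mat (prod_list ns) p (\<lambda>(r, c). entry A (lex_index ns r @ [c]))"
  unfolding right_mat_def using assms by (subst matricize_append[of A ns "[p]"]) simp_all

lemma left_mat_Cons:
  assumes "dims A = p # ns"
  shows "left_mat A = mat p (prod_list ns) (\<lambda>(r, c). entry A (r # lex_index ns c))"
  unfolding left_mat_def using assms by (subst matricize_append[of A "[p]" ns]) simp_all

text \<open>The product sums over all rows, so the lexicographic numbering disappears and
  orthogonality becomes a statement about sums over multi-indices.\<close>

lemma right_mat_transpose_mult:
  assumes "dims A = ns @ [p]" "dims B = ns @ [q]"
  shows "(right_mat A)\<^sup>T * right_mat B =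
    mat p q (\<lambda>(x, y). \<Sum>js\<in>multi_indices ns. entry A (js @ [x]) * entry B (js @ [y]))"
    (is "?L = ?R")
proof (rule eq_matI)
  fix x y assume "x < dim_row ?R" "y < dim_col ?R"
  then show "?L $$ (x, y) = ?R $$ (x, y)"
    unfolding right_mat_snoc[OF assms(1)] right_mat_snoc[OF assms(2)]
    by (simp add: scalar_prod_def atLeast0LessThan
        sum_lex_index[of "\<lambda>js. entry A (js @ [x]) * entry B (js @ [y])"])
qed (simp_all add: right_mat_snoc[OF assms(1)] right_mat_snoc[OF assms(2)])

lemma left_mat_mult_transpose:
  assumes "dims A = p # ns" "dims B = q # ns"
  shows "left_mat A * (left_mat B)\<^sup>T =
    mat p q (\<lambda>(x, y). \<Sum>js\<in>multi_indices ns. entry A (x # js) * entry B (y # js))"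
    (is "?L = ?R")
proof (rule eq_matI)
  fix x y assume "x < dim_row ?R" "y < dim_col ?R"
  then show "?L $$ (x, y) = ?R $$ (x, y)"
    unfolding left_mat_Cons[OF assms(1)] left_mat_Cons[OF assms(2)]
    by (simp add: scalar_prod_def atLeast0LessThan
        sum_lex_index[of "\<lambda>js. entry A (x # js) * entry B (y # js)"])
qed (simp_all add: left_mat_Cons[OF assms(1)] left_mat_Cons[OF assms(2)])

section \<open>Tangent vectors under a rank bound\<close>

text \<open>\<open>\<eta> R\<close> is the projection of \<open>\<xi>\<close> onto the row space of
  \<open>R\<close>. The third conclusion says that the residual \<open>\<xi> - \<eta> R\<close> is
  fixed by \<open>L L^T + W W^T\<close>; it holds because the residual is a limit of matrices whose
  columns lie in the column spaces of the \<open>x m\<close>.\<close>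

lemma bounded_rank_tangent:
  fixes L :: "'a \<Rightarrow> nat \<Rightarrow> real" and R :: "nat \<Rightarrow> 'b \<Rightarrow> real"
  assumes fin: "finite I" "finite J"
    and ort: "\<And>p q. p < k \<Longrightarrow> q < k \<Longrightarrow> (\<Sum>a\<in>I. L a p * L a q) = (if p = q then 1 else 0)"
    and A: "\<And>a b. a \<in> I \<Longrightarrow> b \<in> J \<Longrightarrow> A a b = (\<Sum>q<k. L a q * R q b)"
    and indep: "\<And>c q. (\<And>b. b \<in> J \<Longrightarrow> (\<Sum>q<k. c q * R q b) = 0) \<Longrightarrow> q < k \<Longrightarrow> c q = 0"
    and fac: "\<And>m :: nat. \<exists>f g. \<forall>a\<in>I. \<forall>b\<in>J. x m a b = (\<Sum>l<k + s. f l a * g l b)"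
    and limx: "\<And>a b. a \<in> I \<Longrightarrow> b \<in> J \<Longrightarrow> (\<lambda>m. x m a b) \<longlonglongrightarrow> A a b"
    and limy: "\<And>a b. a \<in> I \<Longrightarrow> b \<in> J \<Longrightarrow> (\<lambda>m. t m * (x m a b - A a b)) \<longlonglongrightarrow> \<xi> a b"
  obtains W :: "'a \<Rightarrow> nat \<Rightarrow> real" and \<eta> :: "'a \<Rightarrow> nat \<Rightarrow> real" where
    "\<And>p q. p < k \<Longrightarrow> q < s \<Longrightarrow> (\<Sum>a\<in>I. L a p * W a q) = 0"
    "\<And>a q. a \<in> I \<Longrightarrow> q < k \<Longrightarrow> (\<Sum>b\<in>J. (\<xi> a b - (\<Sum>q<k. \<eta> a q * R q b)) * R q b) = 0"
    "\<And>a b. a \<in> I \<Longrightarrow> b \<in> J \<Longrightarrow> \<xi> a b - (\<Sum>q<k. \<eta> a q * R q b) =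
      (\<Sum>p<k. L a p * (\<Sum>a'\<in>I. L a' p * (\<xi> a' b - (\<Sum>q<k. \<eta> a' q * R q b)))) +
      (\<Sum>p<s. W a p * (\<Sum>a'\<in>I. W a' p * (\<xi> a' b - (\<Sum>q<k. \<eta> a' q * R q b))))"
proof -
  \<comment> \<open>For each \<open>m\<close>, a projection onto the span of the
    \<open>k + s\<close> left factors; it fixes the columns of \<open>x m\<close>.\<close>
  have "\<exists>P. orth_proj I P \<and> (\<Sum>a\<in>I. P a a) \<le> real (k + s) \<and>
    (\<forall>a\<in>I. \<forall>b\<in>J. (\<Sum>c\<in>I. P a c * x m c b) = x m a b)" for m
  proof -
    obtain f g where "\<forall>a\<in>I. \<forall>b\<in>J. x m a b = (\<Sum>l<k + s. f l a * g l b)"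
      using fac[of m] by (elim exE)
    then have fg: "\<And>a b. a \<in> I \<Longrightarrow> b \<in> J \<Longrightarrow> x m a b = (\<Sum>l<k + s. f l a * g l b)" by simp
    obtain P N where PN: "orth_proj I P \<and> (\<Sum>a\<in>I. P a a) \<le> real (k + s) \<and>
      (\<forall>l<k + s. \<forall>a\<in>I. (\<Sum>b\<in>I. P a b * f l b) = f l a) \<and>
      (\<forall>a\<in>I. \<forall>b\<in>I. P a b = (\<Sum>l<k + s. f l a * N l b))"
      using orth_proj_span[OF fin(1), of "k + s" f] by (elim exE)
    note P = PN[THEN conjunct1] PN[THEN conjunct2, THEN conjunct1]
      PN[THEN conjunct2, THEN conjunct2, THEN conjunct1, rule_format]
    have "(\<Sum>c\<in>I. P a c * x m c b) = x m a b" if ab: "a \<in> I" "b \<in> J" for a b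
    proof -
      have "(\<Sum>c\<in>I. P a c * x m c b) = (\<Sum>c\<in>I. \<Sum>l<k + s. P a c * f l c * g l b)"
        using ab by (intro sum.cong refl) (simp add: fg sum_distrib_left mult.assoc)
      also have "\<dots> = (\<Sum>l<k + s. (\<Sum>c\<in>I. P a c * f l c) * g l b)"
        by (subst sum.swap) (simp add: sum_distrib_right)
      also have "\<dots> = x m a b" using P(3) ab by (simp add: fg)
      finally show ?thesis .
    qed
    then show ?thesis by (intro exI[of _ P] conjI ballI P)
  qed
  then obtain P where P: "\<And>m. orth_proj I (P m)" and trP: "\<And>m. (\<Sum>a\<in>I. P m a a) \<le> real (k + s)"
    and Px: "\<And>m a b. a \<in> I \<Longrightarrow> b \<in> J \<Longrightarrow> (\<Sum>c\<in>I. P m a c * x m c b) = x m a b" by metis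
  \<comment> \<open>Pairs of indices form one finite family, so a single subsequence
    \<open>r\<close> makes all entries of the projections converge.\<close>
  define F where "F = (\<lambda>(a, b) m. P m a b)"
  have "\<exists>r. strict_mono r \<and> (\<forall>i\<in>I \<times> I. convergent (F i \<circ> r))"
    by (rule bounded_family_convergent_subseq[where B = "\<lambda>_. 1"])
      (use fin orth_proj_abs_le_1[OF fin(1) P] in \<open>auto simp: F_def\<close>)
  then obtain r where r: "strict_mono r" "\<forall>i\<in>I \<times> I. convergent (F i \<circ> r)" by blast
  \<comment> \<open>\<open>Q\<close> is the limit called \<open>P\<close> in the opening text.
    Symmetry, idempotence and the trace bound pass to it as closed conditions.\<close>
  define Q where "Q a b = lim (F (a, b) \<circ> r)" for a b
  have limP: "(\<lambda>m. P (r m) a b) \<longlonglongrightarrow> Q a b" if "a \<in> I" "b \<in> I" for a b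
    using r(2) that unfolding convergent_LIMSEQ_iff by (auto simp: Q_def F_def o_def)
  have limx': "(\<lambda>m. x (r m) a b) \<longlonglongrightarrow> A a b" if "a \<in> I" "b \<in> J" for a b
    using LIMSEQ_subseq_LIMSEQ[OF limx[OF that] r(1)] by (simp add: o_def)
  define y where "y m a b = t (r m) * (x (r m) a b - A a b)" for m a b
  have limy': "(\<lambda>m. y m a b) \<longlonglongrightarrow> \<xi> a b" if "a \<in> I" "b \<in> J" for a b
    using LIMSEQ_subseq_LIMSEQ[OF limy[OF that] r(1)] by (simp add: o_def y_def)
  have Q: "orth_proj I Q" unfolding orth_proj_def
  proof (intro conjI ballI)
    fix a b assume ab: "a \<in> I" "b \<in> I"
    have "P m a b = P m b a" for m by (rule orth_proj_sym[OF P ab])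
    then show "Q a b = Q b a" using limP[OF ab] limP[OF ab(2,1)] by (simp add: LIMSEQ_unique)
    have "(\<lambda>m. \<Sum>c\<in>I. P (r m) a c * P (r m) c b) \<longlonglongrightarrow> (\<Sum>c\<in>I. Q a c * Q c b)"
      using ab by (intro tendsto_intros limP) auto
    then show "(\<Sum>c\<in>I. Q a c * Q c b) = Q a b"
      unfolding orth_proj_idem[OF P ab] using limP[OF ab] by (rule LIMSEQ_unique)
  qed
  have "(\<lambda>m. \<Sum>a\<in>I. P (r m) a a) \<longlonglongrightarrow> (\<Sum>a\<in>I. Q a a)" by (intro tendsto_sum limP)
  then have trQ: "(\<Sum>a\<in>I. Q a a) \<le> real (k + s)"
    by (rule LIMSEQ_le_const2) (use trP in auto)
  have QA: "(\<Sum>c\<in>I. Q a c * A c b) = A a b" if ab: "a \<in> I" "b \<in> J" for a b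
  proof -
    have "(\<lambda>m. \<Sum>c\<in>I. P (r m) a c * x (r m) c b) \<longlonglongrightarrow> (\<Sum>c\<in>I. Q a c * A c b)"
      using ab by (intro tendsto_sum tendsto_mult limP limx')
    then show ?thesis unfolding Px[OF ab] using limx'[OF ab] by (rule LIMSEQ_unique)
  qed
  \<comment> \<open>From \<open>Q A = A\<close> it follows that \<open>(Q L - L) R = 0\<close>, and
    the rows of \<open>R\<close> are independent.\<close>
  have QL: "(\<Sum>c\<in>I. Q a c * L c q) = L a q" if a: "a \<in> I" and q: "q < k" for a q
  proof -
    have "(\<Sum>c\<in>I. Q a c * L c q) - L a q = 0"
    proof (rule indep[OF _ q])
      fix b assume b: "b \<in> J"
      have "(\<Sum>q<k. (\<Sum>c\<in>I. Q a c * L c q) * R q b) = (\<Sum>c\<in>I. Q a c * (\<Sum>q<k. L c q * R q b))"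
        unfolding sum_distrib_left sum_distrib_right mult.assoc by (rule sum.swap)
      also have "\<dots> = (\<Sum>c\<in>I. Q a c * A c b)" using A[OF _ b] by simp
      finally show "(\<Sum>q<k. ((\<Sum>c\<in>I. Q a c * L c q) - L a q) * R q b) = 0"
        using QA[OF a b] A[OF a b] by (simp add: left_diff_distrib sum_subtractf)
    qed
    then show ?thesis by simp
  qed
  \<comment> \<open>\<open>T\<close> projects onto the row space of \<open>R\<close>, so
    \<open>1 - T\<close> is the \<open>Q\<close> of the opening text. \<open>N\<close> turns
    \<open>\<xi> T\<close> into a combination of the rows of \<open>R\<close>, which gives
    \<open>\<eta>\<close>.\<close>
  obtain T N where TN: "orth_proj J T \<and> (\<Sum>a\<in>J. T a a) \<le> real k \<and>
      (\<forall>l<k. \<forall>a\<in>J. (\<Sum>b\<in>J. T a b * R l b) = R l a) \<and>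
      (\<forall>a\<in>J. \<forall>b\<in>J. T a b = (\<Sum>l<k. R l a * N l b))"
    using orth_proj_span[OF fin(2), of k R] by (elim exE)
  note T = TN[THEN conjunct1] and TR = TN[THEN conjunct2, THEN conjunct2, THEN conjunct1, rule_format]
    and N = TN[THEN conjunct2, THEN conjunct2, THEN conjunct2, rule_format]
  have TR': "(\<Sum>b'\<in>J. R l b' * T b b') = R l b" if "l < k" "b \<in> J" for l b
    using TR[OF that] by (simp add: mult.commute)
  define \<eta> where "\<eta> a q = (\<Sum>b\<in>J. \<xi> a b * N q b)" for a q
  define \<zeta> where "\<zeta> a b = \<xi> a b - (\<Sum>b'\<in>J. \<xi> a b' * T b b')" for a b
  have \<zeta>: "\<zeta> a b = \<xi> a b - (\<Sum>q<k. \<eta> a q * R q b)" if b: "b \<in> J" for a b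
  proof -
    have "(\<Sum>b'\<in>J. \<xi> a b' * T b b') = (\<Sum>b'\<in>J. \<Sum>q<k. \<xi> a b' * N q b' * R q b)"
      using N[OF b] by (intro sum.cong refl) (simp add: sum_distrib_left mult_ac)
    also have "\<dots> = (\<Sum>q<k. \<eta> a q * R q b)"
      by (subst sum.swap) (simp add: \<eta>_def sum_distrib_right)
    finally show ?thesis by (simp add: \<zeta>_def)
  qed
  have \<zeta>R: "(\<Sum>b\<in>J. \<zeta> a b * R q b) = 0" if q: "q < k" for a q
  proof -
    have "(\<Sum>b\<in>J. (\<Sum>b'\<in>J. \<xi> a b' * T b b') * R q b) = (\<Sum>b'\<in>J. \<xi> a b' * (\<Sum>b\<in>J. T b b' * R q b))"
      unfolding sum_distrib_left sum_distrib_right mult.assoc by (rule sum.swap)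
    also have "\<dots> = (\<Sum>b'\<in>J. \<xi> a b' * (\<Sum>b\<in>J. T b' b * R q b))"
      by (intro sum.cong refl arg_cong[where f = "(*) _"]) (simp add: orth_proj_sym[OF T])
    also have "\<dots> = (\<Sum>b'\<in>J. \<xi> a b' * R q b')" using TR[OF q] by simp
    finally show ?thesis by (simp add: \<zeta>_def left_diff_distrib sum_subtractf)
  qed
  have AT: "(\<Sum>b'\<in>J. A a b' * T b b') = A a b" if a: "a \<in> I" and b: "b \<in> J" for a b
  proof -
    have "(\<Sum>b'\<in>J. A a b' * T b b') = (\<Sum>b'\<in>J. \<Sum>q<k. L a q * (R q b' * T b b'))"
      using A[OF a] by (intro sum.cong refl) (simp add: sum_distrib_right mult.assoc)
    also have "\<dots> = (\<Sum>q<k. L a q * (\<Sum>b'\<in>J. R q b' * T b b'))"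
      by (subst sum.swap) (simp add: sum_distrib_left)
    also have "\<dots> = A a b" using TR'[OF _ b] A[OF a b] by simp
    finally show ?thesis .
  qed
  \<comment> \<open>The difference quotient times \<open>1 - T\<close>. Since
    \<open>A T = A\<close>, the contribution of \<open>A\<close> cancels and only a multiple of
    \<open>x (1 - T)\<close> is left, whose columns are fixed by the projection
    \<open>P (r m)\<close>.\<close>
  define z where "z m a b = y m a b - (\<Sum>b'\<in>J. y m a b' * T b b')" for m a b
  have limz: "(\<lambda>m. z m a b) \<longlonglongrightarrow> \<zeta> a b" if "a \<in> I" "b \<in> J" for a b
    unfolding z_def \<zeta>_def using that by (intro tendsto_diff tendsto_sum tendsto_mult tendsto_const limy')
  have z: "z m a b = t (r m) * (x (r m) a b - (\<Sum>b'\<in>J. x (r m) a b' * T b b'))"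
    if "a \<in> I" "b \<in> J" for m a b
  proof -
    have "(\<Sum>b'\<in>J. y m a b' * T b b') =
      t (r m) * ((\<Sum>b'\<in>J. x (r m) a b' * T b b') - (\<Sum>b'\<in>J. A a b' * T b b'))"
      unfolding y_def sum_subtractf[symmetric] sum_distrib_left
      by (intro sum.cong refl) (simp add: algebra_simps)
    then show ?thesis using AT[OF that] by (simp add: z_def y_def algebra_simps)
  qed
  have Pz: "(\<Sum>c\<in>I. P (r m) a c * z m c b) = z m a b" if ab: "a \<in> I" "b \<in> J" for m a b
  proof -
    have "(\<Sum>c\<in>I. P (r m) a c * z m c b) =
      (\<Sum>c\<in>I. t (r m) * (P (r m) a c * x (r m) c b - (\<Sum>b'\<in>J. P (r m) a c * x (r m) c b' * T b b')))"
      using ab by (intro sum.cong refl) (simp add: z right_diff_distrib sum_distrib_left mult_ac)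
    also have "\<dots> = t (r m) * ((\<Sum>c\<in>I. P (r m) a c * x (r m) c b) -
       (\<Sum>c\<in>I. \<Sum>b'\<in>J. P (r m) a c * x (r m) c b' * T b b'))"
      by (simp only: sum_distrib_left[symmetric] sum_subtractf)
    also have "(\<Sum>c\<in>I. \<Sum>b'\<in>J. P (r m) a c * x (r m) c b' * T b b') =
      (\<Sum>b'\<in>J. (\<Sum>c\<in>I. P (r m) a c * x (r m) c b') * T b b')"
      by (subst sum.swap) (simp only: sum_distrib_right)
    also have "\<dots> = (\<Sum>b'\<in>J. x (r m) a b' * T b b')"
      using Px[OF ab(1)] by simp
    also have "t (r m) * ((\<Sum>c\<in>I. P (r m) a c * x (r m) c b) - \<dots>) = z m a b"
      using Px[OF ab] z[OF ab] by simp
    finally show ?thesis .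
  qed
  have Q\<zeta>: "(\<Sum>c\<in>I. Q a c * \<zeta> c b) = \<zeta> a b" if ab: "a \<in> I" "b \<in> J" for a b
  proof -
    have "(\<lambda>m. \<Sum>c\<in>I. P (r m) a c * z m c b) \<longlonglongrightarrow> (\<Sum>c\<in>I. Q a c * \<zeta> c b)"
      using ab by (intro tendsto_sum tendsto_mult limP limz)
    then show ?thesis unfolding Pz[OF ab] using limz[OF ab] by (rule LIMSEQ_unique)
  qed
  \<comment> \<open>The part of the limit projection orthogonal to \<open>L\<close>. Its trace is at
    most \<open>s\<close>, so it decomposes into \<open>s\<close> vectors, the columns of
    \<open>W\<close>.\<close>
  define S where "S a b = Q a b - (\<Sum>p<k. L a p * L b p)" for a b
  have S: "orth_proj I S"
    unfolding S_def by (rule orth_proj_diff_orthonormal(1)[OF fin(1) Q ort QL])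
  have "(\<Sum>a\<in>I. S a a) = (\<Sum>a\<in>I. Q a a) - real k"
    unfolding S_def by (rule orth_proj_diff_orthonormal(2)[OF fin(1) Q ort QL])
  then have trS: "(\<Sum>a\<in>I. S a a) \<le> real s" using trQ by simp
  have SL0: "(\<Sum>b\<in>I. S a b * L b q) = 0" if "q < k" "a \<in> I" for q a
    unfolding S_def by (rule orth_proj_diff_orthonormal(3)[OF fin(1) Q ort QL that])
  obtain u where u: "(\<forall>a\<in>I. \<forall>b\<in>I. S a b = (\<Sum>l<s. u l a * u l b)) \<and>
     (\<forall>l<s. \<forall>a\<in>I. (\<Sum>b\<in>I. S a b * u l b) = u l a)"
    using orth_proj_decompose[OF fin(1) S trS] by (elim exE)
  note u1 = u[THEN conjunct1, rule_format] and u2 = u[THEN conjunct2, rule_format]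
  have SL: "(\<Sum>b\<in>I. L b q * S b a) = 0" if "q < k" "a \<in> I" for q a
  proof -
    have "(\<Sum>b\<in>I. L b q * S b a) = (\<Sum>b\<in>I. S a b * L b q)"
      using that by (intro sum.cong refl) (simp add: orth_proj_sym[OF S, of a])
    then show ?thesis using SL0[OF that] by simp
  qed
  show thesis
  proof (rule that[of "\<lambda>a l. u l a" \<eta>])
    fix p q assume pq: "p < k" "q < s"
    have "(\<Sum>a\<in>I. L a p * u q a) = (\<Sum>a\<in>I. L a p * (\<Sum>b\<in>I. S a b * u q b))"
      using u2[OF pq(2)] by simp
    also have "\<dots> = (\<Sum>b\<in>I. (\<Sum>a\<in>I. L a p * S a b) * u q b)"
      unfolding sum_distrib_left sum_distrib_right mult.assoc by (rule sum.swap)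
    also have "\<dots> = 0" using SL[OF pq(1)] by simp
    finally show "(\<Sum>a\<in>I. L a p * u q a) = 0" .
  next
    fix a q assume "a \<in> I" "q < k"
    then show "(\<Sum>b\<in>J. (\<xi> a b - (\<Sum>q<k. \<eta> a q * R q b)) * R q b) = 0"
      using \<zeta>R[of q a] by (simp add: \<zeta>)
  next
    fix a b assume ab: "a \<in> I" "b \<in> J"
    have Q': "Q a c = (\<Sum>p<k. L a p * L c p) + (\<Sum>l<s. u l a * u l c)" if "c \<in> I" for c
    proof -
      have "S a c = (\<Sum>l<s. u l a * u l c)" by (rule u1[OF ab(1) that])
      then show ?thesis by (simp add: S_def)
    qed
    have "\<zeta> a b = (\<Sum>c\<in>I. Q a c * \<zeta> c b)" using Q\<zeta>[OF ab] by simp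
    also have "\<dots> = (\<Sum>c\<in>I. ((\<Sum>p<k. L a p * L c p) + (\<Sum>l<s. u l a * u l c)) * \<zeta> c b)"
      using Q' by (intro sum.cong refl) simp
    also have "\<dots> = (\<Sum>c\<in>I. \<Sum>p<k. L a p * (L c p * \<zeta> c b)) + (\<Sum>c\<in>I. \<Sum>p<s. u p a * (u p c * \<zeta> c b))"
      by (simp only: distrib_right sum.distrib sum_distrib_right mult.assoc)
    also have "\<dots> = (\<Sum>p<k. L a p * (\<Sum>c\<in>I. L c p * \<zeta> c b)) + (\<Sum>p<s. u p a * (\<Sum>c\<in>I. u p c * \<zeta> c b))"
      unfolding sum_distrib_left by (subst (1 2) sum.swap) (rule refl)
    finally show "\<xi> a b - (\<Sum>q<k. \<eta> a q * R q b) =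
      (\<Sum>p<k. L a p * (\<Sum>a'\<in>I. L a' p * (\<xi> a' b - (\<Sum>q<k. \<eta> a' q * R q b)))) +
      (\<Sum>p<s. u p a * (\<Sum>a'\<in>I. u p a' * (\<xi> a' b - (\<Sum>q<k. \<eta> a' q * R q b))))"
      unfolding \<zeta>[OF ab(2)] .
  qed
qed

section \<open>The decomposition of a tangent vector\<close>

declare upt_Suc [simp del]

text \<open>
  Level \<open>i\<close> is the interface between the cores \<open>i\<close> and \<open>i + 1\<close>; the first core gets a left index
  of range \<open>\<kappa> 0 = 1\<close>.
\<close>

locale tt_cores =
  fixes d :: nat and n \<kappa> :: "nat \<Rightarrow> nat"
    and C :: "nat \<Rightarrow> nat \<Rightarrow> nat \<Rightarrow> nat \<Rightarrow> real" and R :: "nat \<Rightarrow> nat \<Rightarrow> nat list \<Rightarrow> real"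
  assumes rank_0: "\<kappa> 0 = 1"
    and C_orth: "\<And>i q q'. Suc i < d \<Longrightarrow> q < \<kappa> (Suc i) \<Longrightarrow> q' < \<kappa> (Suc i) \<Longrightarrow>
      (\<Sum>p<\<kappa> i. \<Sum>j<n (Suc i). C (Suc i) p j q * C (Suc i) p j q') = (if q = q' then 1 else 0)"
    and R_rec: "\<And>i p j b. Suc i < d \<Longrightarrow> p < \<kappa> i \<Longrightarrow> j < n (Suc i) \<Longrightarrow>
      b \<in> multi_indices (map n [Suc (Suc i)..<Suc d]) \<Longrightarrow>
      R i p (j # b) = (\<Sum>q<\<kappa> (Suc i). C (Suc i) p j q * R (Suc i) q b)"
begin

abbreviation I :: "nat \<Rightarrow> nat list set" where
  "I i \<equiv> multi_indices (map n [1..<Suc i])"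

abbreviation J :: "nat \<Rightarrow> nat list set" where
  "J i \<equiv> multi_indices (map n [Suc i..<Suc d])"

text \<open>The product of the first \<open>i\<close> cores, built by appending a core on the right;
  for \<open>i = 0\<close> it is the scalar 1 at the empty multi-index.\<close>

primrec L :: "nat \<Rightarrow> nat list \<Rightarrow> nat \<Rightarrow> real" where
  "L 0 a q = 1"
| "L (Suc i) a q = (\<Sum>p<\<kappa> i. L i (butlast a) p * C (Suc i) p (last a) q)"

lemma I_Suc: "map n [1..<Suc (Suc i)] = map n [1..<Suc i] @ [n (Suc i)]"
  by (simp add: upt_Suc)

lemma J_Suc: "i < d \<Longrightarrow> map n [Suc i..<Suc d] = n (Suc i) # map n [Suc (Suc i)..<Suc d]"
  by (subst upt_conv_Cons) auto

lemma sum_I_Suc: "(\<Sum>a\<in>I (Suc i). f a) = (\<Sum>a\<in>I i. \<Sum>j<n (Suc i). f (a @ [j]))"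
  unfolding I_Suc by (rule sum_multi_indices_snoc)

lemma sum_J_Suc: "i < d \<Longrightarrow> (\<Sum>b\<in>J i. f b) = (\<Sum>j<n (Suc i). \<Sum>b\<in>J (Suc i). f (j # b))"
  unfolding J_Suc by (rule sum_multi_indices_Cons)

lemma snoc_in_I: "a \<in> I i \<Longrightarrow> j < n (Suc i) \<Longrightarrow> a @ [j] \<in> I (Suc i)"
  unfolding I_Suc by (subst append_in_multi_indices) (auto dest: multi_indices_length)

lemma Cons_in_J: "i < d \<Longrightarrow> j < n (Suc i) \<Longrightarrow> b \<in> J (Suc i) \<Longrightarrow> j # b \<in> J i"
  unfolding J_Suc by simp

lemma in_I_Suc_cases:
  assumes "a \<in> I (Suc i)"
  obtains a' j where "a = a' @ [j]" "a' \<in> I i" "j < n (Suc i)"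
proof -
  have "length a = Suc i" using multi_indices_length[OF assms] by simp
  then obtain a' j where a: "a = a' @ [j]" and l: "length a' = i"
    by (metis length_Suc_conv_rev)
  have "a' \<in> I i \<and> [j] \<in> multi_indices [n (Suc i)]"
    using assms append_in_multi_indices[of a' "map n [1..<Suc i]" "[j]" "[n (Suc i)]"]
    unfolding I_Suc a using l by simp
  then show thesis using a that by simp
qed

text \<open>By \<open>R_rec\<close> one core at a time moves from the right factor to the left one;
  level 0 is the whole tensor.\<close>

lemma factorization:
  assumes "i < d" "a \<in> I i" "b \<in> J i"
  shows "R 0 0 (a @ b) = (\<Sum>q<\<kappa> i. L i a q * R i q b)"
  using assms
proof (induction i arbitrary: a b)
  case 0
  then show ?case by (simp add: rank_0)
next
  case (Suc i)
  obtain a' j where a: "a = a' @ [j]" "a' \<in> I i" "j < n (Suc i)" by (rule in_I_Suc_cases[OF Suc.prems(2)])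
  have "R 0 0 (a @ b) = (\<Sum>p<\<kappa> i. L i a' p * R i p (j # b))"
    using Suc.IH[of a' "j # b"] Suc.prems a Cons_in_J[of i j b] by simp
  also have "\<dots> = (\<Sum>p<\<kappa> i. \<Sum>q<\<kappa> (Suc i). L i a' p * C (Suc i) p j q * R (Suc i) q b)"
    using Suc.prems a by (intro sum.cong refl) (simp add: R_rec sum_distrib_left mult.assoc)
  also have "\<dots> = (\<Sum>q<\<kappa> (Suc i). L (Suc i) a q * R (Suc i) q b)"
    by (subst sum.swap) (simp add: a sum_distrib_right)
  finally show ?case .
qed

text \<open>Contracting with \<open>L (Suc i)\<close> is contracting with \<open>L i\<close> and
  then with the next core. Every orthogonality to a core below is obtained by reading this from
  right to left or from left to right.\<close>

lemma L_contract:
  "(\<Sum>a\<in>I (Suc i). L (Suc i) a q * g a) =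
   (\<Sum>p<\<kappa> i. \<Sum>j<n (Suc i). C (Suc i) p j q * (\<Sum>a\<in>I i. L i a p * g (a @ [j])))"
proof -
  have "(\<Sum>a\<in>I (Suc i). L (Suc i) a q * g a) =
     (\<Sum>a\<in>I i. \<Sum>j<n (Suc i). \<Sum>p<\<kappa> i. C (Suc i) p j q * (L i a p * g (a @ [j])))"
    unfolding sum_I_Suc by (intro sum.cong refl) (simp add: sum_distrib_left sum_distrib_right mult_ac)
  also have "\<dots> = (\<Sum>a\<in>I i. \<Sum>p<\<kappa> i. \<Sum>j<n (Suc i). C (Suc i) p j q * (L i a p * g (a @ [j])))"
    by (rule sum.cong[OF refl sum.swap])
  also have "\<dots> = (\<Sum>p<\<kappa> i. \<Sum>a\<in>I i. \<Sum>j<n (Suc i). C (Suc i) p j q * (L i a p * g (a @ [j])))"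
    by (rule sum.swap)
  also have "\<dots> = (\<Sum>p<\<kappa> i. \<Sum>j<n (Suc i). \<Sum>a\<in>I i. C (Suc i) p j q * (L i a p * g (a @ [j])))"
    by (rule sum.cong[OF refl sum.swap])
  finally show ?thesis by (simp only: sum_distrib_left)
qed

text \<open>Orthonormality at level \<open>i\<close> is a hypothesis here because
  \<open>L_orth\<close> needs this identity within its own induction.\<close>

lemma L_L_snoc_of_orth:
  assumes "\<And>r. r < \<kappa> i \<Longrightarrow> (\<Sum>a\<in>I i. L i a p * L i a r) = (if p = r then 1 else 0)" "p < \<kappa> i"
  shows "(\<Sum>a\<in>I i. L i a p * L (Suc i) (a @ [j]) q) = C (Suc i) p j q"
proof -
  have "(\<Sum>a\<in>I i. L i a p * L (Suc i) (a @ [j]) q) =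
    (\<Sum>r<\<kappa> i. (\<Sum>a\<in>I i. L i a p * L i a r) * C (Suc i) r j q)"
    unfolding L.simps sum_distrib_left sum_distrib_right
    by (subst sum.swap) (simp add: mult.assoc)
  also have "\<dots> = (\<Sum>r<\<kappa> i. if r = p then C (Suc i) r j q else 0)"
    using assms by (intro sum.cong refl) auto
  finally show ?thesis using assms by simp
qed

text \<open>Contracting the first \<open>i\<close> cores gives the identity by induction, and the
  last core is orthonormal by \<open>C_orth\<close>.\<close>

lemma L_orth:
  assumes "i < d" "p < \<kappa> i" "q < \<kappa> i"
  shows "(\<Sum>a\<in>I i. L i a p * L i a q) = (if p = q then 1 else 0)"
  using assms
proof (induction i arbitrary: p q)
  case 0
  then show ?case by (simp add: rank_0)
next
  case (Suc i)
  have "(\<Sum>a\<in>I i. L i a p' * L (Suc i) (a @ [j]) q) = C (Suc i) p' j q" if "p' < \<kappa> i" for p' j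
    using Suc that by (intro L_L_snoc_of_orth) auto
  then have "(\<Sum>a\<in>I (Suc i). L (Suc i) a p * L (Suc i) a q) =
    (\<Sum>p'<\<kappa> i. \<Sum>j<n (Suc i). C (Suc i) p' j p * C (Suc i) p' j q)"
    unfolding L_contract by (intro sum.cong refl arg_cong[where f = "(*) _"]) simp
  then show ?case using C_orth[of i p q] Suc.prems by simp
qed

lemma L_L_snoc:
  "i < d \<Longrightarrow> p < \<kappa> i \<Longrightarrow> (\<Sum>a\<in>I i. L i a p * L (Suc i) (a @ [j]) q) = C (Suc i) p j q"
  by (intro L_L_snoc_of_orth L_orth)

end

section \<open>Blocks of a vector with the residual property at every interface, and their
  recursions\<close>

locale tt_tangent = tt_cores d n \<kappa> C R
  for d :: nat and n \<kappa> :: "nat \<Rightarrow> nat"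
    and C :: "nat \<Rightarrow> nat \<Rightarrow> nat \<Rightarrow> nat \<Rightarrow> real" and R :: "nat \<Rightarrow> nat \<Rightarrow> nat list \<Rightarrow> real" +
  fixes \<sigma> :: "nat \<Rightarrow> nat" and W \<eta> :: "nat \<Rightarrow> nat list \<Rightarrow> nat \<Rightarrow> real" and \<xi> :: "nat list \<Rightarrow> real"
  assumes L_W: "\<And>i p q. 0 < i \<Longrightarrow> i < d \<Longrightarrow> p < \<kappa> i \<Longrightarrow> q < \<sigma> i \<Longrightarrow> (\<Sum>a\<in>I i. L i a p * W i a q) = 0"
    \<comment> \<open>\<open>\<eta> i a\<close> are the coefficients of the least squares approximation of \<open>\<xi>\<close> by the rows of \<open>R i\<close>.\<close>
    and residual_orth: "\<And>i a q. 0 < i \<Longrightarrow> i < d \<Longrightarrow> a \<in> I i \<Longrightarrow> q < \<kappa> i \<Longrightarrow>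
      (\<Sum>b\<in>J i. (\<xi> (a @ b) - (\<Sum>q<\<kappa> i. \<eta> i a q * R i q b)) * R i q b) = 0"
    and residual: "\<And>i a b. 0 < i \<Longrightarrow> i < d \<Longrightarrow> a \<in> I i \<Longrightarrow> b \<in> J i \<Longrightarrow>
      \<xi> (a @ b) - (\<Sum>q<\<kappa> i. \<eta> i a q * R i q b) =
      (\<Sum>p<\<kappa> i. L i a p * (\<Sum>a'\<in>I i. L i a' p * (\<xi> (a' @ b) - (\<Sum>q<\<kappa> i. \<eta> i a' q * R i q b)))) +
      (\<Sum>p<\<sigma> i. W i a p * (\<Sum>a'\<in>I i. W i a' p * (\<xi> (a' @ b) - (\<Sum>q<\<kappa> i. \<eta> i a' q * R i q b))))"
begin

text \<open>The first two block rows of the product of the block tensors after level \<open>i\<close>.\<close>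

definition Xr :: "nat \<Rightarrow> nat \<Rightarrow> nat list \<Rightarrow> real" where
  "Xr i p b = (\<Sum>a\<in>I i. L i a p * \<xi> (a @ b))"

definition Vr :: "nat \<Rightarrow> nat \<Rightarrow> nat list \<Rightarrow> real" where
  "Vr i p b = (\<Sum>a\<in>I i. W i a p * (\<xi> (a @ b) - (\<Sum>q<\<kappa> i. \<eta> i a q * R i q b)))"

text \<open>The matrix \<open>L^T \<eta>\<close>, that is, the component of \<open>\<eta>\<close>
  along the columns of \<open>L\<close>. It is the correction that makes \<open>Xf\<close>
  orthogonal to the core.\<close>

definition h :: "nat \<Rightarrow> nat \<Rightarrow> nat \<Rightarrow> real" where
  "h i p q = (\<Sum>a\<in>I i. L i a p * \<eta> i a q)"

text \<open>\<open>Uf\<close> and \<open>Zf\<close> are the coefficients of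
  \<open>W (Suc i)\<close>, sliced at its last index, with respect to \<open>L i\<close> and
  \<open>W i\<close>. The values at core number 0 are dummies, as cores are counted from 1.\<close>

fun Uf :: "nat \<Rightarrow> nat \<Rightarrow> nat \<Rightarrow> nat \<Rightarrow> real" where
  "Uf (Suc i) p j q = (\<Sum>a\<in>I i. L i a p * W (Suc i) (a @ [j]) q)"
| "Uf 0 p j q = 0"

fun Zf :: "nat \<Rightarrow> nat \<Rightarrow> nat \<Rightarrow> nat \<Rightarrow> real" where
  "Zf (Suc i) p j q = (\<Sum>a\<in>I i. W i a p * W (Suc i) (a @ [j]) q)"
| "Zf 0 p j q = 0"

text \<open>The contraction of \<open>\<eta> (Suc i)\<close> with \<open>L i\<close>, minus its
  orthogonal projection onto the columns of the core.\<close>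

fun Xf :: "nat \<Rightarrow> nat \<Rightarrow> nat \<Rightarrow> nat \<Rightarrow> real" where
  "Xf (Suc i) p j q =
     (\<Sum>a\<in>I i. L i a p * \<eta> (Suc i) (a @ [j]) q) - (\<Sum>p'<\<kappa> (Suc i). C (Suc i) p j p' * h (Suc i) p' q)"
| "Xf 0 p j q = 0"

text \<open>The coefficients of \<open>R (Suc i)\<close> in \<open>Vr i\<close>: the approximation
  at the finer level minus the one at level \<open>i\<close>, the latter carried through the
  core.\<close>

fun Vf :: "nat \<Rightarrow> nat \<Rightarrow> nat \<Rightarrow> nat \<Rightarrow> real" where
  "Vf (Suc i) p j q =
     (\<Sum>a\<in>I i. W i a p * (\<eta> (Suc i) (a @ [j]) q - (\<Sum>q'<\<kappa> i. \<eta> i a q' * C (Suc i) q' j q)))"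
| "Vf 0 p j q = 0"

lemma L_residual:
  "(\<Sum>a\<in>I i. L i a p * (\<xi> (a @ b) - (\<Sum>q<\<kappa> i. \<eta> i a q * R i q b))) =
   Xr i p b - (\<Sum>q<\<kappa> i. h i p q * R i q b)"
proof -
  have "(\<Sum>a\<in>I i. L i a p * (\<Sum>q<\<kappa> i. \<eta> i a q * R i q b)) = (\<Sum>q<\<kappa> i. h i p q * R i q b)"
    unfolding h_def sum_distrib_left sum_distrib_right mult.assoc by (rule sum.swap)
  then show ?thesis by (simp add: Xr_def right_diff_distrib sum_subtractf)
qed

text \<open>The residual identity at level \<open>Suc i\<close>, solved for \<open>\<xi>\<close> and
  contracted with weights \<open>w\<close>; the index \<open>j\<close> is the last one on the left
  there and the first one on the right at level \<open>i\<close>. The weights \<open>L i\<close>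
  lead to \<open>Xr_rec\<close>, the weights \<open>W i\<close> to \<open>Vr_rec\<close>.\<close>

lemma slice:
  assumes i: "Suc i < d" and j: "j < n (Suc i)" and b: "b \<in> J (Suc i)"
  shows "(\<Sum>a\<in>I i. w a * \<xi> (a @ j # b)) =
    (\<Sum>q<\<kappa> (Suc i). (\<Sum>a\<in>I i. w a * \<eta> (Suc i) (a @ [j]) q) * R (Suc i) q b) +
    (\<Sum>p<\<kappa> (Suc i). (\<Sum>a\<in>I i. w a * L (Suc i) (a @ [j]) p) *
        (Xr (Suc i) p b - (\<Sum>q<\<kappa> (Suc i). h (Suc i) p q * R (Suc i) q b))) +
    (\<Sum>p<\<sigma> (Suc i). (\<Sum>a\<in>I i. w a * W (Suc i) (a @ [j]) p) * Vr (Suc i) p b)"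
    (is "_ = ?A + ?B + ?D")
proof -
  have \<xi>: "\<xi> (a @ j # b) = (\<Sum>q<\<kappa> (Suc i). \<eta> (Suc i) (a @ [j]) q * R (Suc i) q b) +
    (\<Sum>p<\<kappa> (Suc i). L (Suc i) (a @ [j]) p *
        (Xr (Suc i) p b - (\<Sum>q<\<kappa> (Suc i). h (Suc i) p q * R (Suc i) q b))) +
    (\<Sum>p<\<sigma> (Suc i). W (Suc i) (a @ [j]) p * Vr (Suc i) p b)" if "a \<in> I i" for a
    using residual[OF zero_less_Suc i snoc_in_I[OF that j] b]
    unfolding L_residual Vr_def[symmetric] by simp
  have "(\<Sum>a\<in>I i. w a * \<xi> (a @ j # b)) =
    (\<Sum>a\<in>I i. w a * (\<Sum>q<\<kappa> (Suc i). \<eta> (Suc i) (a @ [j]) q * R (Suc i) q b)) +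
    (\<Sum>a\<in>I i. w a * (\<Sum>p<\<kappa> (Suc i). L (Suc i) (a @ [j]) p *
        (Xr (Suc i) p b - (\<Sum>q<\<kappa> (Suc i). h (Suc i) p q * R (Suc i) q b)))) +
    (\<Sum>a\<in>I i. w a * (\<Sum>p<\<sigma> (Suc i). W (Suc i) (a @ [j]) p * Vr (Suc i) p b))"
    by (simp only: \<xi> distrib_left sum.distrib cong: sum.cong)
  moreover have "(\<Sum>a\<in>I i. w a * (\<Sum>q<m. f a q * g q)) = (\<Sum>q<m. (\<Sum>a\<in>I i. w a * f a q) * g q)"
    for m :: nat and f :: "nat list \<Rightarrow> nat \<Rightarrow> real" and g
    unfolding sum_distrib_left sum_distrib_right mult.assoc by (rule sum.swap)
  ultimately show ?thesis by (simp only:)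
qed

text \<open>With weights \<open>L i\<close> the slices of \<open>L (Suc i)\<close> contract to the
  core, and the \<open>h\<close> terms are absorbed into \<open>Xf\<close>. This is the first row of
  the block core.\<close>

lemma Xr_rec:
  assumes i: "Suc i < d" and p: "p < \<kappa> i" and j: "j < n (Suc i)" and b: "b \<in> J (Suc i)"
  shows "Xr i p (j # b) = (\<Sum>q<\<kappa> (Suc i). C (Suc i) p j q * Xr (Suc i) q b) +
    (\<Sum>q<\<sigma> (Suc i). Uf (Suc i) p j q * Vr (Suc i) q b) +
    (\<Sum>q<\<kappa> (Suc i). Xf (Suc i) p j q * R (Suc i) q b)"
proof -
  have swap: "(\<Sum>r<\<kappa> (Suc i). C (Suc i) p j r * (\<Sum>q<\<kappa> (Suc i). h (Suc i) r q * R (Suc i) q b)) =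
    (\<Sum>q<\<kappa> (Suc i). (\<Sum>r<\<kappa> (Suc i). C (Suc i) p j r * h (Suc i) r q) * R (Suc i) q b)"
    unfolding sum_distrib_left sum_distrib_right mult.assoc by (rule sum.swap)
  have LC: "(\<Sum>a\<in>I i. L i a p * L (Suc i) (a @ [j]) q) = C (Suc i) p j q" for q
    using i p by (intro L_L_snoc) auto
  have "Xr i p (j # b) =
    (\<Sum>q<\<kappa> (Suc i). (\<Sum>a\<in>I i. L i a p * \<eta> (Suc i) (a @ [j]) q) * R (Suc i) q b) +
    (\<Sum>r<\<kappa> (Suc i). C (Suc i) p j r *
        (Xr (Suc i) r b - (\<Sum>q<\<kappa> (Suc i). h (Suc i) r q * R (Suc i) q b))) +
    (\<Sum>q<\<sigma> (Suc i). Uf (Suc i) p j q * Vr (Suc i) q b)"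
    unfolding Xr_def[of i] slice[OF i j b] LC Uf.simps ..
  then show ?thesis
    by (simp add: right_diff_distrib left_diff_distrib sum_subtractf swap)
qed

text \<open>This is the second row of the block core; its first entry is zero because
  \<open>W i\<close> is orthogonal to \<open>L i\<close>.\<close>

lemma Vr_rec:
  assumes i: "Suc i < d" "0 < i" and p: "p < \<sigma> i" and j: "j < n (Suc i)" and b: "b \<in> J (Suc i)"
  shows "Vr i p (j # b) = (\<Sum>q<\<sigma> (Suc i). Zf (Suc i) p j q * Vr (Suc i) q b) +
    (\<Sum>q<\<kappa> (Suc i). Vf (Suc i) p j q * R (Suc i) q b)"
proof -
  \<comment> \<open>Every slice of \<open>L (Suc i)\<close> is a combination of columns of
    \<open>L i\<close>.\<close>
  have WL: "(\<Sum>a\<in>I i. W i a p * L (Suc i) (a @ [j]) q) = 0" for q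
  proof -
    have "(\<Sum>a\<in>I i. W i a p * L (Suc i) (a @ [j]) q) =
      (\<Sum>r<\<kappa> i. (\<Sum>a\<in>I i. L i a r * W i a p) * C (Suc i) r j q)"
      unfolding L.simps sum_distrib_left sum_distrib_right
      by (subst sum.swap) (simp add: mult_ac)
    also have "\<dots> = 0" using L_W[of i _ p] i p by (intro sum.neutral) auto
    finally show ?thesis .
  qed
  \<comment> \<open>The approximation at level \<open>i\<close> is rewritten in the rows of
    \<open>R (Suc i)\<close>, where it joins the coefficients collected in
    \<open>Vf\<close>.\<close>
  have \<eta>R: "(\<Sum>q<\<kappa> i. \<eta> i a q * R i q (j # b)) =
    (\<Sum>q<\<kappa> (Suc i). (\<Sum>q'<\<kappa> i. \<eta> i a q' * C (Suc i) q' j q) * R (Suc i) q b)" for a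
  proof -
    have "(\<Sum>q<\<kappa> i. \<eta> i a q * R i q (j # b)) =
      (\<Sum>q<\<kappa> i. \<eta> i a q * (\<Sum>q'<\<kappa> (Suc i). C (Suc i) q j q' * R (Suc i) q' b))"
      using R_rec[OF i(1) _ j b] by simp
    then show ?thesis
      unfolding sum_distrib_left sum_distrib_right mult.assoc by (simp only: sum.swap[of _ "{..<\<kappa> i}"])
  qed
  have 1: "Vr i p (j # b) = (\<Sum>a\<in>I i. W i a p * \<xi> (a @ j # b)) -
    (\<Sum>a\<in>I i. W i a p * (\<Sum>q<\<kappa> (Suc i). (\<Sum>q'<\<kappa> i. \<eta> i a q' * C (Suc i) q' j q) * R (Suc i) q b))"
    unfolding Vr_def[of i] \<eta>R right_diff_distrib sum_subtractf ..
  have 2: "(\<Sum>a\<in>I i. W i a p * (\<Sum>q<\<kappa> (Suc i). (\<Sum>q'<\<kappa> i. \<eta> i a q' * C (Suc i) q' j q) * R (Suc i) q b)) =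
    (\<Sum>q<\<kappa> (Suc i). (\<Sum>a\<in>I i. W i a p * (\<Sum>q'<\<kappa> i. \<eta> i a q' * C (Suc i) q' j q)) * R (Suc i) q b)"
    unfolding sum_distrib_left[of "W i _ p"] sum_distrib_right[of _ _ "R (Suc i) _ b"] mult.assoc
    by (rule sum.swap)
  show ?thesis unfolding 1 2 slice[OF i(1) j b] WL
    by (simp add: right_diff_distrib left_diff_distrib sum_subtractf)
qed

text \<open>Each row of \<open>Vr\<close> is a combination of rows of the residual, all of which are
  orthogonal to \<open>R\<close>.\<close>

lemma Vr_orth:
  assumes i: "0 < i" "i < d" and q: "q < \<kappa> i"
  shows "(\<Sum>b\<in>J i. Vr i p b * R i q b) = 0"
proof -
  have "(\<Sum>b\<in>J i. Vr i p b * R i q b) =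
    (\<Sum>a\<in>I i. W i a p * (\<Sum>b\<in>J i. (\<xi> (a @ b) - (\<Sum>q<\<kappa> i. \<eta> i a q * R i q b)) * R i q b))"
    unfolding Vr_def sum_distrib_left[of "W i _ p"] sum_distrib_right[of _ _ "R i q _"] mult.assoc
    by (rule sum.swap)
  also have "\<dots> = 0" using residual_orth[OF i _ q] by (intro sum.neutral) auto
  finally show ?thesis .
qed

text \<open>By \<open>L_contract\<close> the sum equals the inner product of a column of
  \<open>L (Suc i)\<close> with a column of \<open>W (Suc i)\<close>.\<close>

lemma Uf_orth:
  assumes i: "Suc i < d" "q < \<kappa> (Suc i)" "q' < \<sigma> (Suc i)"
  shows "(\<Sum>p<\<kappa> i. \<Sum>j<n (Suc i). C (Suc i) p j q * Uf (Suc i) p j q') = 0"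
  using L_W[OF zero_less_Suc i] unfolding L_contract by simp

text \<open>Both parts of \<open>Xf\<close> contract with the core to \<open>h\<close>: the
  subtracted one since the core is orthonormal, the other by \<open>L_contract\<close>.\<close>

lemma Xf_orth:
  assumes i: "Suc i < d" and q: "q < \<kappa> (Suc i)"
  shows "(\<Sum>p<\<kappa> i. \<Sum>j<n (Suc i). C (Suc i) p j q * Xf (Suc i) p j q') = 0"
proof -
  have "(\<Sum>p<\<kappa> i. \<Sum>j<n (Suc i). C (Suc i) p j q * (\<Sum>r<\<kappa> (Suc i). C (Suc i) p j r * h (Suc i) r q')) =
    (\<Sum>p<\<kappa> i. \<Sum>r<\<kappa> (Suc i). \<Sum>j<n (Suc i). C (Suc i) p j q * C (Suc i) p j r * h (Suc i) r q')"
    unfolding sum_distrib_left mult.assoc by (rule sum.cong[OF refl sum.swap])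
  also have "\<dots> = (\<Sum>r<\<kappa> (Suc i). (\<Sum>p<\<kappa> i. \<Sum>j<n (Suc i). C (Suc i) p j q * C (Suc i) p j r) * h (Suc i) r q')"
    by (subst sum.swap) (simp only: sum_distrib_right)
  also have "\<dots> = (\<Sum>r<\<kappa> (Suc i). if r = q then h (Suc i) r q' else 0)"
    using C_orth[OF i q] by (intro sum.cong refl) auto
  also have "\<dots> = h (Suc i) q q'" using q by simp
  also have "\<dots> = (\<Sum>p<\<kappa> i. \<Sum>j<n (Suc i). C (Suc i) p j q * (\<Sum>a\<in>I i. L i a p * \<eta> (Suc i) (a @ [j]) q'))"
    unfolding h_def L_contract ..
  finally show ?thesis by (simp add: right_diff_distrib sum_subtractf)
qed

text \<open>In \<open>Vr_rec\<close> both \<open>Vr i\<close> and the \<open>Zf\<close> part are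
  orthogonal to \<open>R i\<close>, hence so is the remaining \<open>Vf\<close> part.\<close>

lemma Vf_orth:
  assumes i: "Suc i < d" "0 < i" and p: "p < \<sigma> i" and q: "q < \<kappa> i"
  shows "(\<Sum>j<n (Suc i). \<Sum>b\<in>J (Suc i).
    (\<Sum>q'<\<kappa> (Suc i). Vf (Suc i) p j q' * R (Suc i) q' b) * R i q (j # b)) = 0"
proof -
  \<comment> \<open>Each slice of \<open>R i\<close> is a combination of rows of
    \<open>R (Suc i)\<close>, to which \<open>Vr (Suc i)\<close> is orthogonal.\<close>
  have Z0: "(\<Sum>b\<in>J (Suc i). (\<Sum>r<\<sigma> (Suc i). Zf (Suc i) p j r * Vr (Suc i) r b) * R i q (j # b)) = 0"
    if j: "j < n (Suc i)" for j
  proof -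
    have VR: "(\<Sum>b\<in>J (Suc i). Vr (Suc i) r b * R i q (j # b)) = 0" for r
    proof -
      have "(\<Sum>b\<in>J (Suc i). Vr (Suc i) r b * R i q (j # b)) =
        (\<Sum>b\<in>J (Suc i). \<Sum>q'<\<kappa> (Suc i). C (Suc i) q j q' * (Vr (Suc i) r b * R (Suc i) q' b))"
        using R_rec[OF i(1) q j] by (intro sum.cong refl) (simp add: sum_distrib_left mult_ac)
      also have "\<dots> = (\<Sum>q'<\<kappa> (Suc i). C (Suc i) q j q' * (\<Sum>b\<in>J (Suc i). Vr (Suc i) r b * R (Suc i) q' b))"
        unfolding sum_distrib_left by (rule sum.swap)
      finally show ?thesis using Vr_orth[OF zero_less_Suc i(1)] by simp
    qed
    have "(\<Sum>b\<in>J (Suc i). (\<Sum>r<\<sigma> (Suc i). Zf (Suc i) p j r * Vr (Suc i) r b) * R i q (j # b)) =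
      (\<Sum>r<\<sigma> (Suc i). Zf (Suc i) p j r * (\<Sum>b\<in>J (Suc i). Vr (Suc i) r b * R i q (j # b)))"
      unfolding sum_distrib_left sum_distrib_right mult.assoc by (rule sum.swap)
    then show ?thesis using VR by simp
  qed
  have "0 = (\<Sum>b\<in>J i. Vr i p b * R i q b)" using Vr_orth i q by simp
  also have "\<dots> = (\<Sum>j<n (Suc i). \<Sum>b\<in>J (Suc i). Vr i p (j # b) * R i q (j # b))"
    using i by (intro sum_J_Suc) simp
  also have "\<dots> = (\<Sum>j<n (Suc i). \<Sum>b\<in>J (Suc i).
      (\<Sum>r<\<sigma> (Suc i). Zf (Suc i) p j r * Vr (Suc i) r b) * R i q (j # b) +
      (\<Sum>q'<\<kappa> (Suc i). Vf (Suc i) p j q' * R (Suc i) q' b) * R i q (j # b))"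
    using Vr_rec[OF i p] by (intro sum.cong refl) (simp only: distrib_right lessThan_iff)
  also have "\<dots> = (\<Sum>j<n (Suc i). \<Sum>b\<in>J (Suc i).
      (\<Sum>q'<\<kappa> (Suc i). Vf (Suc i) p j q' * R (Suc i) q' b) * R i q (j # b))"
    using Z0 by (simp add: sum.distrib)
  finally show ?thesis by simp
qed

end

section \<open>Products of block tensors\<close>

lemma dims_tt_mult [simp]: "dims (A \<star> B) = butlast (dims A) @ tl (dims B)"
  by (simp add: tt_mult_def)

lemma entry_tt_mult:
  assumes "dims A = ns @ [K]" "dims B = K # ms" "a \<in> multi_indices ns" "b \<in> multi_indices ms"
  shows "entry (A \<star> B) (a @ b) = (\<Sum>m<K. entry A (a @ [m]) * entry B (m # b))"
  using assms multi_indices_length[OF assms(3)]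
  by (simp add: tt_mult_def entry_mk_tensor Let_def)

lemma entry_join_last:
  assumes "dims A = ns @ [p]" "dims B = ns @ [q]" "a \<in> multi_indices ns"
  shows "m < p \<Longrightarrow> entry (join_last A B) (a @ [m]) = entry A (a @ [m])"
    and "m < q \<Longrightarrow> entry (join_last A B) (a @ [p + m]) = entry B (a @ [m])"
  using assms multi_indices_length[OF assms(3)]
  by (simp_all add: join_last_def entry_mk_tensor)

lemma dims_join_last:
  "dims A = ns @ [p] \<Longrightarrow> dims B = ns @ [q] \<Longrightarrow> dims (join_last A B) = ns @ [p + q]"
  by (simp add: join_last_def)

lemma entry_join_first:
  assumes "dims A = p # ns" "dims B = q # ns" "a \<in> multi_indices ns"
  shows "m < p \<Longrightarrow> entry (join_first A B) (m # a) = entry A (m # a)"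
    and "m < q \<Longrightarrow> entry (join_first A B) ((p + m) # a) = entry B (m # a)"
  using assms by (simp_all add: join_first_def entry_mk_tensor)

lemma dims_join_first:
  "dims A = p # ns \<Longrightarrow> dims B = q # ns \<Longrightarrow> dims (join_first A B) = (p + q) # ns"
  by (simp add: join_first_def)

text \<open>The bracketing of the offsets follows the right nesting of
  \<open>block_row\<close>.\<close>

lemma block_row_3:
  assumes "dims A = ns @ [p]" "dims B = ns @ [q]" "dims D = ns @ [r]"
  shows "dims (block_row [A, B, D]) = ns @ [p + (q + r)]"
    and "a \<in> multi_indices ns \<Longrightarrow> m < p \<Longrightarrow> entry (block_row [A, B, D]) (a @ [m]) = entry A (a @ [m])"
    and "a \<in> multi_indices ns \<Longrightarrow> m < q \<Longrightarrow> entry (block_row [A, B, D]) (a @ [p + m]) = entry B (a @ [m])"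
    and "a \<in> multi_indices ns \<Longrightarrow> m < r \<Longrightarrow>
      entry (block_row [A, B, D]) (a @ [p + (q + m)]) = entry D (a @ [m])"
proof -
  note BD = dims_join_last[OF assms(2,3)]
  show "dims (block_row [A, B, D]) = ns @ [p + (q + r)]"
    using dims_join_last[OF assms(1) BD] by simp
  assume a: "a \<in> multi_indices ns"
  note 1 = entry_join_last[OF assms(1) BD a] and 2 = entry_join_last[OF assms(2,3) a]
  show "m < p \<Longrightarrow> entry (block_row [A, B, D]) (a @ [m]) = entry A (a @ [m])"
    using 1(1) by simp
  show "m < q \<Longrightarrow> entry (block_row [A, B, D]) (a @ [p + m]) = entry B (a @ [m])"
    using 1(2)[of m] 2(1)[of m] by simp
  show "m < r \<Longrightarrow> entry (block_row [A, B, D]) (a @ [p + (q + m)]) = entry D (a @ [m])"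
    using 1(2)[of "q + m"] 2(2)[of m] by simp
qed

lemma block_col_3:
  assumes "dims A = p # ns" "dims B = q # ns" "dims D = r # ns"
  shows "dims (block_col [A, B, D]) = (p + (q + r)) # ns"
    and "a \<in> multi_indices ns \<Longrightarrow> m < p \<Longrightarrow> entry (block_col [A, B, D]) (m # a) = entry A (m # a)"
    and "a \<in> multi_indices ns \<Longrightarrow> m < q \<Longrightarrow> entry (block_col [A, B, D]) ((p + m) # a) = entry B (m # a)"
    and "a \<in> multi_indices ns \<Longrightarrow> m < r \<Longrightarrow>
      entry (block_col [A, B, D]) ((p + (q + m)) # a) = entry D (m # a)"
proof -
  note BD = dims_join_first[OF assms(2,3)]
  show "dims (block_col [A, B, D]) = (p + (q + r)) # ns"
    using dims_join_first[OF assms(1) BD] by simp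
  assume a: "a \<in> multi_indices ns"
  note 1 = entry_join_first[OF assms(1) BD a] and 2 = entry_join_first[OF assms(2,3) a]
  show "m < p \<Longrightarrow> entry (block_col [A, B, D]) (m # a) = entry A (m # a)"
    using 1(1) by simp
  show "m < q \<Longrightarrow> entry (block_col [A, B, D]) ((p + m) # a) = entry B (m # a)"
    using 1(2)[of m] 2(1)[of m] by simp
  show "m < r \<Longrightarrow> entry (block_col [A, B, D]) ((p + (q + m)) # a) = entry D (m # a)"
    using 1(2)[of "q + m"] 2(2)[of m] by simp
qed

lemma sum_lessThan_add:
  fixes f :: "nat \<Rightarrow> real"
  shows "(\<Sum>m<p + q. f m) = (\<Sum>m<p. f m) + (\<Sum>m<q. f (p + m))"
  by (induction q) (simp_all add: add_ac)

section \<open>Peeling the leading core off a TT product\<close>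

lemma tt_prod_upt:
  "i < d \<Longrightarrow> tt_prod (map f [i..<Suc d]) = f i \<star> tt_prod (map f [Suc i..<Suc d])"
  by (simp add: upt_conv_Cons[of i] upt_conv_Cons[of "Suc i"])

text \<open>Stated for any family of cores and any ranks \<open>K\<close>, as it serves both for the
  given cores and for the block cores.\<close>

lemma dims_tt_prod_suffix:
  assumes "i < d" "0 < i"
    and "\<And>i. 0 < i \<Longrightarrow> Suc i < d \<Longrightarrow> dims (f (Suc i)) = [K i, n (Suc i), K (Suc i)]"
    and "dims (f d) = [K (d - 1), n d]"
  shows "dims (tt_prod (map f [Suc i..<Suc d])) = K i # map n [Suc i..<Suc d]"
  using assms(1,2)
proof (induction "d - i" arbitrary: i rule: less_induct)
  case less
  show ?case
  proof (cases "Suc i = d")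
    case True
    then show ?thesis using assms(4) by (auto simp: upt_conv_Cons)
  next
    case False
    then have i: "Suc i < d" using less by simp
    have "dims (tt_prod (map f [Suc (Suc i)..<Suc d])) = K (Suc i) # map n [Suc (Suc i)..<Suc d]"
      using less i by (intro less.hyps) auto
    moreover have "[Suc i..<Suc d] = Suc i # [Suc (Suc i)..<Suc d]"
      using i by (simp add: upt_conv_Cons)
    ultimately show ?thesis
      unfolding tt_prod_upt[OF i] using assms(3)[OF less.prems(2) i] by simp
  qed
qed

lemma entry_tt_prod_suffix:
  assumes i: "Suc i < d" "0 < i"
    and f: "\<And>i. 0 < i \<Longrightarrow> Suc i < d \<Longrightarrow> dims (f (Suc i)) = [K i, n (Suc i), K (Suc i)]"
    and fd: "dims (f d) = [K (d - 1), n d]"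
    and "p < K i" "j < n (Suc i)" "b \<in> multi_indices (map n [Suc (Suc i)..<Suc d])"
  shows "entry (tt_prod (map f [Suc i..<Suc d])) (p # j # b) =
    (\<Sum>m<K (Suc i). entry (f (Suc i)) [p, j, m] * entry (tt_prod (map f [Suc (Suc i)..<Suc d])) (m # b))"
  unfolding tt_prod_upt[OF i(1)]
  using entry_tt_mult[of "f (Suc i)" "[K i, n (Suc i)]" "K (Suc i)"
      "tt_prod (map f [Suc (Suc i)..<Suc d])" "map n [Suc (Suc i)..<Suc d]" "[p, j]" b]
    f[OF i(2,1)] dims_tt_prod_suffix[of "Suc i" d f K n] f fd i assms(5-) by simp

text \<open>The first core has order 2, without a left index, and is therefore treated apart from
  the others.\<close>

lemma entry_tt_prod_first:
  assumes "2 \<le> d" and f1: "dims (f 1) = [n 1, K 1]"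
    and f: "\<And>i. 0 < i \<Longrightarrow> Suc i < d \<Longrightarrow> dims (f (Suc i)) = [K i, n (Suc i), K (Suc i)]"
    and fd: "dims (f d) = [K (d - 1), n d]"
    and "j < n 1" "b \<in> multi_indices (map n [Suc 1..<Suc d])"
  shows "entry (tt_prod (map f [1..<Suc d])) (j # b) =
    (\<Sum>m<K 1. entry (f 1) [j, m] * entry (tt_prod (map f [Suc 1..<Suc d])) (m # b))"
  using entry_tt_mult[of "f 1" "[n 1]" "K 1"
      "tt_prod (map f [Suc 1..<Suc d])" "map n [Suc 1..<Suc d]" "[j]" b]
    tt_prod_upt[of 1 d f] dims_tt_prod_suffix[of 1 d f K n] assms by simp

lemma tendsto_fun_apply:
  fixes f :: "nat \<Rightarrow> 'a \<Rightarrow> real"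
  assumes "f \<longlonglongrightarrow> g"
  shows "(\<lambda>m. f m x) \<longlonglongrightarrow> g x"
  using continuous_on_tendsto_compose[OF continuous_on_product_coordinates[where i = x] assms] by simp

section \<open>The given decomposition of \<open>A\<close> as an instance of the abstract
  cores\<close>

locale tt_setting =
  fixes d :: nat and n k :: "nat \<Rightarrow> nat" and A :: tensor and Ac :: "nat \<Rightarrow> tensor"
  assumes d: "2 \<le> d"
    and A_rank: "A \<in> tt_manifold (map n [1..<Suc d]) k"
    and Ac_1: "Ac 1 \<in> tensors [n 1, k 1]"
    and Ac_mid: "\<forall>i\<in>{2..d-1}. Ac i \<in> tensors [k (i-1), n i, k i]"
    and Ac_d: "Ac d \<in> tensors [k (d-1), n d]"
    and A_prod: "tt_prod (map Ac [1..<Suc d]) = A"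
    and Ac_orth: "\<forall>i\<in>{1..d-1}. (right_mat (Ac i))\<^sup>T * right_mat (Ac i) = 1\<^sub>m (k i)"
begin

lemma dims_Ac_1: "dims (Ac 1) = [n 1, k 1]"
  using Ac_1 by (simp add: tensors_def)

lemma dims_Ac_d: "dims (Ac d) = [k (d - 1), n d]"
  using Ac_d by (simp add: tensors_def)

lemma dims_Ac_Suc: "0 < i \<Longrightarrow> Suc i < d \<Longrightarrow> dims (Ac (Suc i)) = [k i, n (Suc i), k (Suc i)]"
  using Ac_mid[rule_format, of "Suc i"] by (simp add: tensors_def)

lemma dims_A: "dims A = map n [1..<Suc d]"
  using A_rank by (simp add: tt_manifold_def tensors_def)

text \<open>The value \<open>k 0\<close> is arbitrary; the artificial left index of the first core
  has range 1.\<close>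

definition \<kappa> :: "nat \<Rightarrow> nat" where
  "\<kappa> i = (if i = 0 then 1 else k i)"

text \<open>Gives all cores the same three arguments; the first one ignores its left index.\<close>

definition core :: "nat \<Rightarrow> nat \<Rightarrow> nat \<Rightarrow> nat \<Rightarrow> real" where
  "core i p j q = (if i = 1 then entry (Ac 1) [j, q] else entry (Ac i) [p, j, q])"

text \<open>The product of the cores after level \<open>i\<close>. Level 0 is \<open>A\<close>
  itself, with the artificial index \<open>p\<close> ignored.\<close>

definition R :: "nat \<Rightarrow> nat \<Rightarrow> nat list \<Rightarrow> real" where
  "R i p b = (if i = 0 then entry A b else entry (tt_prod (map Ac [Suc i..<Suc d])) (p # b))"

lemma R_pos: "0 < i \<Longrightarrow> R i p b = entry (tt_prod (map Ac [Suc i..<Suc d])) (p # b)"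
  by (simp add: R_def)

text \<open>Covers the first core of order 2 and the middle ones of order 3 at once;
  \<open>T\<close> is going to be \<open>Ac\<close>, \<open>U\<close> or \<open>X\<close>.\<close>

lemma right_mat_Ac_mult:
  assumes i: "Suc i < d" and T: "dims T = (if i = 0 then [n 1, t] else [k i, n (Suc i), t])"
    and q: "q < k (Suc i)" "q' < t"
  shows "((right_mat (Ac (Suc i)))\<^sup>T * right_mat T) $$ (q, q') =
    (\<Sum>p<\<kappa> i. \<Sum>j<n (Suc i). core (Suc i) p j q * entry T (if i = 0 then [j, q'] else [p, j, q']))"
proof (cases "i = 0")
  case True
  have "dims T = [n 1] @ [t]" "dims (Ac 1) = [n 1] @ [k 1]"
    using T True dims_Ac_1 by simp_all
  from right_mat_transpose_mult[OF this(2,1)] show ?thesis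
    using True q by (simp add: \<kappa>_def core_def sum_multi_indices_Cons)
next
  case False
  then have "dims T = [k i, n (Suc i)] @ [t]" "dims (Ac (Suc i)) = [k i, n (Suc i)] @ [k (Suc i)]"
    using T i dims_Ac_Suc[of i] by simp_all
  from right_mat_transpose_mult[OF this(2,1)] show ?thesis
    using False q by (simp add: \<kappa>_def core_def sum_multi_indices_Cons)
qed

sublocale tt_cores d n \<kappa> core R
proof
  show "\<kappa> 0 = 1" by (simp add: \<kappa>_def)
next
  fix i q q' assume i: "Suc i < d" "q < \<kappa> (Suc i)" "q' < \<kappa> (Suc i)"
  have q: "q < k (Suc i)" "q' < k (Suc i)" using i by (simp_all add: \<kappa>_def)
  have "dims (Ac (Suc i)) = (if i = 0 then [n 1, k (Suc i)] else [k i, n (Suc i), k (Suc i)])"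
    using dims_Ac_1 dims_Ac_Suc i by simp
  from right_mat_Ac_mult[OF i(1) this q]
  have "(\<Sum>p<\<kappa> i. \<Sum>j<n (Suc i). core (Suc i) p j q * core (Suc i) p j q') =
    ((right_mat (Ac (Suc i)))\<^sup>T * right_mat (Ac (Suc i))) $$ (q, q')"
    by (cases "i = 0") (simp_all add: core_def)
  also have "\<dots> = (1\<^sub>m (k (Suc i))) $$ (q, q')" using Ac_orth[rule_format, of "Suc i"] i by simp
  finally show "(\<Sum>p<\<kappa> i. \<Sum>j<n (Suc i). core (Suc i) p j q * core (Suc i) p j q') =
    (if q = q' then 1 else 0)" using q by simp
next
  fix i p j b assume i: "Suc i < d" and p: "p < \<kappa> i" and j: "j < n (Suc i)"
    and b: "b \<in> multi_indices (map n [Suc (Suc i)..<Suc d])"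
  show "R i p (j # b) = (\<Sum>q<\<kappa> (Suc i). core (Suc i) p j q * R (Suc i) q b)"
  proof (cases "i = 0")
    case True
    then show ?thesis
      using entry_tt_prod_first[OF d dims_Ac_1 dims_Ac_Suc dims_Ac_d, of j b, unfolded A_prod] j b
      by (simp add: R_def \<kappa>_def core_def)
  next
    case False
    then show ?thesis
      using entry_tt_prod_suffix[OF i _ dims_Ac_Suc dims_Ac_d, of p j b] p j b
      by (simp add: R_def \<kappa>_def core_def)
  qed
qed

lemma entry_A: "i < d \<Longrightarrow> a \<in> I i \<Longrightarrow> b \<in> J i \<Longrightarrow> entry A (a @ b) = (\<Sum>q<\<kappa> i. L i a q * R i q b)"
  using factorization[of i a b] by (simp add: R_def)

lemma split_dims: "i < d \<Longrightarrow> map n [1..<Suc d] = map n [1..<Suc i] @ map n [Suc i..<Suc d]"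
  using upt_add_eq_append[of 1 "Suc i" "d - i"] by (simp flip: map_append)

text \<open>Here the exact rank \<open>k i\<close> of the matricization of \<open>A\<close> enters:
  it leaves no room for a relation between the \<open>k i\<close> rows.\<close>

lemma R_independent:
  assumes i: "0 < i" "i < d" and c: "\<And>b. b \<in> J i \<Longrightarrow> (\<Sum>q<k i. c q * R i q b) = 0" and q: "q < k i"
  shows "c q = 0"
proof (rule full_rank_factor_independent[OF _ _ _ c q])
  show "dims A = map n [1..<Suc i] @ map n [Suc i..<Suc d]" using dims_A split_dims[OF i(2)] by simp
  show "entry A (a @ b) = (\<Sum>l<k i. L i a l * R i l b)" if "a \<in> I i" "b \<in> J i" for a b
    using entry_A[OF i(2) that] i by (simp add: \<kappa>_def)
  show "mat_rank (matricize (length (map n [1..<Suc i])) A) = k i"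
    using A_rank i by (simp add: tt_manifold_def)
qed

text \<open>\<open>bounded_rank_tangent\<close> for the matricization at level \<open>i\<close>: the
  rank bound of the variety factors each \<open>x m\<close>, and convergence is used
  entrywise.\<close>

lemma tangent_cone_residual:
  assumes X: "\<X> \<in> tangent_cone (tt_variety (map n [1..<Suc d]) (\<lambda>i. k i + s i)) A"
    and i: "0 < i" "i < d"
  obtains W \<eta> where
    "\<And>p q. p < k i \<Longrightarrow> q < s i \<Longrightarrow> (\<Sum>a\<in>I i. L i a p * W a q) = 0"
    "\<And>a q. a \<in> I i \<Longrightarrow> q < k i \<Longrightarrow>
      (\<Sum>b\<in>J i. (entry \<X> (a @ b) - (\<Sum>q<k i. \<eta> a q * R i q b)) * R i q b) = 0"
    "\<And>a b. a \<in> I i \<Longrightarrow> b \<in> J i \<Longrightarrow> entry \<X> (a @ b) - (\<Sum>q<k i. \<eta> a q * R i q b) =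
      (\<Sum>p<k i. L i a p * (\<Sum>a'\<in>I i. L i a' p * (entry \<X> (a' @ b) - (\<Sum>q<k i. \<eta> a' q * R i q b)))) +
      (\<Sum>p<s i. W a p * (\<Sum>a'\<in>I i. W a' p * (entry \<X> (a' @ b) - (\<Sum>q<k i. \<eta> a' q * R i q b))))"
proof -
  obtain x t where x: "\<And>m :: nat. x m \<in> tt_variety (map n [1..<Suc d]) (\<lambda>i. k i + s i)"
    and lim: "(\<lambda>m. entry (x m)) \<longlonglongrightarrow> entry A"
      "(\<lambda>m js. t m * (entry (x m) js - entry A js)) \<longlonglongrightarrow> entry \<X>"
    using X by (auto simp: tangent_cone_def)
  have ki: "\<kappa> i = k i" using i by (simp add: \<kappa>_def)
  show thesis
  proof (rule bounded_rank_tangent[where I = "I i" and J = "J i" and k = "k i" and s = "s i" and L = "L i"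
        and R = "R i" and A = "\<lambda>a b. entry A (a @ b)" and x = "\<lambda>m a b. entry (x m) (a @ b)"
        and t = t and \<xi> = "\<lambda>a b. entry \<X> (a @ b)"])
    show "(\<Sum>a\<in>I i. L i a p * L i a q) = (if p = q then 1 else 0)" if "p < k i" "q < k i" for p q
      using L_orth[OF i(2)] that by (simp add: ki)
    show "entry A (a @ b) = (\<Sum>q<k i. L i a q * R i q b)" if "a \<in> I i" "b \<in> J i" for a b
      using entry_A[OF i(2) that] by (simp add: ki)
    show "c q = 0" if "\<And>b. b \<in> J i \<Longrightarrow> (\<Sum>q<k i. c q * R i q b) = 0" "q < k i" for c q
      by (rule R_independent[OF i that])
    show "\<exists>f g. \<forall>a\<in>I i. \<forall>b\<in>J i. entry (x m) (a @ b) = (\<Sum>l<k i + s i. f l a * g l b)" for m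
    proof (rule matricize_factorization)
      show "dims (x m) = map n [1..<Suc i] @ map n [Suc i..<Suc d]"
        using x[of m] split_dims[OF i(2)] by (simp add: tt_variety_def tensors_def)
      show "mat_rank (matricize (length (map n [1..<Suc i])) (x m)) \<le> k i + s i"
        using x[of m] i by (simp add: tt_variety_def)
    qed
    show "(\<lambda>m. entry (x m) (a @ b)) \<longlonglongrightarrow> entry A (a @ b)" for a b
      by (rule tendsto_fun_apply[OF lim(1)])
    show "(\<lambda>m. t m * (entry (x m) (a @ b) - entry A (a @ b))) \<longlonglongrightarrow> entry \<X> (a @ b)" for a b
      by (rule tendsto_fun_apply[OF lim(2)])
    show "finite (I i)" "finite (J i)" by (rule finite_multi_indices)+
  qed (rule that)
qed

end

section \<open>The block decomposition\<close>

context tt_setting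
begin

section \<open>The blocks as tensors, and the product of the block cores\<close>

context
  fixes s \<sigma> :: "nat \<Rightarrow> nat" and W \<eta> :: "nat \<Rightarrow> nat list \<Rightarrow> nat \<Rightarrow> real" and \<X> :: tensor
  assumes tangent: "tt_tangent d n \<kappa> core R \<sigma> W \<eta> (entry \<X>)"
    and \<sigma>: "\<forall>i>0. \<sigma> i = s i"
    and dims_X: "dims \<X> = map n [1..<Suc d]"
begin

interpretation T: tt_tangent d n \<kappa> core R \<sigma> W \<eta> "entry \<X>"
  by (rule tangent)

definition U :: "nat \<Rightarrow> tensor" where
  "U i = (if i = 1 then mk_tensor [n 1, s 1] (\<lambda>js. T.Uf 1 0 (js ! 0) (js ! 1))
    else mk_tensor [k (i - 1), n i, s i] (\<lambda>js. T.Uf i (js ! 0) (js ! 1) (js ! 2)))"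

text \<open>After the last interface a single index remains, so the last core is the row
  \<open>Xr (d - 1)\<close> itself, evaluated at a list of length one. \<open>V d\<close> is formed
  from \<open>Vr (d - 1)\<close> in the same way.\<close>

definition X :: "nat \<Rightarrow> tensor" where
  "X i = (if i = 1 then mk_tensor [n 1, k 1] (\<lambda>js. T.Xf 1 0 (js ! 0) (js ! 1))
    else if i = d then mk_tensor [k (d - 1), n d] (\<lambda>js. T.Xr (d - 1) (js ! 0) [js ! 1])
    else mk_tensor [k (i - 1), n i, k i] (\<lambda>js. T.Xf i (js ! 0) (js ! 1) (js ! 2)))"

definition Z :: "nat \<Rightarrow> tensor" where
  "Z i = mk_tensor [s (i - 1), n i, s i] (\<lambda>js. T.Zf i (js ! 0) (js ! 1) (js ! 2))"

definition V :: "nat \<Rightarrow> tensor" where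
  "V i = (if i = d then mk_tensor [s (d - 1), n d] (\<lambda>js. T.Vr (d - 1) (js ! 0) [js ! 1])
    else mk_tensor [s (i - 1), n i, k i] (\<lambda>js. T.Vf i (js ! 0) (js ! 1) (js ! 2)))"

lemma shapes:
  "dims (U 1) = [n 1, s 1]" "dims (X 1) = [n 1, k 1]"
  "dims (X d) = [k (d - 1), n d]" "dims (V d) = [s (d - 1), n d]"
  "0 < i \<Longrightarrow> Suc i < d \<Longrightarrow> dims (U (Suc i)) = [k i, n (Suc i), s (Suc i)]"
  "0 < i \<Longrightarrow> Suc i < d \<Longrightarrow> dims (X (Suc i)) = [k i, n (Suc i), k (Suc i)]"
  "dims (Z (Suc i)) = [s i, n (Suc i), s (Suc i)]"
  "Suc i < d \<Longrightarrow> dims (V (Suc i)) = [s i, n (Suc i), k (Suc i)]"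
  using d by (simp_all add: U_def X_def Z_def V_def)

lemma entries_1:
  "j < n 1 \<Longrightarrow> q < s 1 \<Longrightarrow> entry (U 1) [j, q] = T.Uf 1 0 j q"
  "j < n 1 \<Longrightarrow> q < k 1 \<Longrightarrow> entry (X 1) [j, q] = T.Xf 1 0 j q"
  by (simp_all add: U_def X_def entry_mk_tensor)

lemma entries_d:
  "p < k (d - 1) \<Longrightarrow> j < n d \<Longrightarrow> entry (X d) [p, j] = T.Xr (d - 1) p [j]"
  "p < s (d - 1) \<Longrightarrow> j < n d \<Longrightarrow> entry (V d) [p, j] = T.Vr (d - 1) p [j]"
  using d by (simp_all add: X_def V_def entry_mk_tensor)

lemma entries_Suc:
  assumes "0 < i" "Suc i < d" "j < n (Suc i)"
  shows "p < k i \<Longrightarrow> q < s (Suc i) \<Longrightarrow> entry (U (Suc i)) [p, j, q] = T.Uf (Suc i) p j q"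
    and "p < k i \<Longrightarrow> q < k (Suc i) \<Longrightarrow> entry (X (Suc i)) [p, j, q] = T.Xf (Suc i) p j q"
    and "p < s i \<Longrightarrow> q < s (Suc i) \<Longrightarrow> entry (Z (Suc i)) [p, j, q] = T.Zf (Suc i) p j q"
    and "p < s i \<Longrightarrow> q < k (Suc i) \<Longrightarrow> entry (V (Suc i)) [p, j, q] = T.Vf (Suc i) p j q"
  using assms by (simp_all add: U_def X_def Z_def V_def entry_mk_tensor del: T.Uf.simps T.Xf.simps T.Zf.simps T.Vf.simps)

definition block :: "nat \<Rightarrow> tensor" where
  "block i = (if i = 1 then block_tensor [[Ac 1, U 1, X 1]]
    else if i = d then block_tensor [[X d], [V d], [Ac d]]
    else block_tensor
      [[Ac i, U i, X i],
       [zero_tensor [s (i-1), n i, k i], Z i, V i],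
       [zero_tensor [k (i-1), n i, k i], zero_tensor [k (i-1), n i, s i], Ac i]])"

text \<open>The rank of the block product at interface \<open>i\<close>, bracketed as in
  \<open>block_row_3\<close> and \<open>block_col_3\<close>.\<close>

definition K :: "nat \<Rightarrow> nat" where
  "K i = k i + (s i + k i)"

lemma entry_zero_tensor: "entry (zero_tensor ns) js = 0"
  by (simp add: zero_tensor_def entry_mk_tensor)

lemma dims_zero_tensor: "dims (zero_tensor ns) = ns"
  by (simp add: zero_tensor_def)

lemma block_1:
  shows "dims (block 1) = [n 1, K 1]"
    and "j < n 1 \<Longrightarrow> m < k 1 \<Longrightarrow> entry (block 1) [j, m] = entry (Ac 1) [j, m]"
    and "j < n 1 \<Longrightarrow> m < s 1 \<Longrightarrow> entry (block 1) [j, k 1 + m] = entry (U 1) [j, m]"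
    and "j < n 1 \<Longrightarrow> m < k 1 \<Longrightarrow> entry (block 1) [j, k 1 + (s 1 + m)] = entry (X 1) [j, m]"
proof -
  have b: "block 1 = block_row [Ac 1, U 1, X 1]" by (simp add: block_def block_tensor_def)
  note br = block_row_3[of "Ac 1" "[n 1]" "k 1" "U 1" "s 1" "X 1" "k 1"]
  show "dims (block 1) = [n 1, K 1]"
    unfolding b using br(1) dims_Ac_1 shapes by (simp add: K_def del: block_row.simps)
  show "j < n 1 \<Longrightarrow> m < k 1 \<Longrightarrow> entry (block 1) [j, m] = entry (Ac 1) [j, m]"
    unfolding b using br(2)[of "[j]" m] dims_Ac_1 shapes by (simp del: block_row.simps)
  show "j < n 1 \<Longrightarrow> m < s 1 \<Longrightarrow> entry (block 1) [j, k 1 + m] = entry (U 1) [j, m]"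
    unfolding b using br(3)[of "[j]" m] dims_Ac_1 shapes by (simp del: block_row.simps)
  show "j < n 1 \<Longrightarrow> m < k 1 \<Longrightarrow> entry (block 1) [j, k 1 + (s 1 + m)] = entry (X 1) [j, m]"
    unfolding b using br(4)[of "[j]" m] dims_Ac_1 shapes by (simp del: block_row.simps)
qed

lemma block_d:
  shows "dims (block d) = [K (d - 1), n d]"
    and "j < n d \<Longrightarrow> m < k (d - 1) \<Longrightarrow> entry (block d) [m, j] = entry (X d) [m, j]"
    and "j < n d \<Longrightarrow> m < s (d - 1) \<Longrightarrow> entry (block d) [k (d - 1) + m, j] = entry (V d) [m, j]"
    and "j < n d \<Longrightarrow> m < k (d - 1) \<Longrightarrow>
      entry (block d) [k (d - 1) + (s (d - 1) + m), j] = entry (Ac d) [m, j]"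
proof -
  have b: "block d = block_col [X d, V d, Ac d]"
    using d by (simp add: block_def block_tensor_def)
  note br = block_col_3[of "X d" "k (d - 1)" "[n d]" "V d" "s (d - 1)" "Ac d" "k (d - 1)"]
  show "dims (block d) = [K (d - 1), n d]"
    unfolding b using br(1) dims_Ac_d shapes by (simp add: K_def del: block_col.simps)
  show "j < n d \<Longrightarrow> m < k (d - 1) \<Longrightarrow> entry (block d) [m, j] = entry (X d) [m, j]"
    unfolding b using br(2)[of "[j]" m] dims_Ac_d shapes by (simp del: block_col.simps)
  show "j < n d \<Longrightarrow> m < s (d - 1) \<Longrightarrow> entry (block d) [k (d - 1) + m, j] = entry (V d) [m, j]"
    unfolding b using br(3)[of "[j]" m] dims_Ac_d shapes by (simp del: block_col.simps)
  show "j < n d \<Longrightarrow> m < k (d - 1) \<Longrightarrow>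
      entry (block d) [k (d - 1) + (s (d - 1) + m), j] = entry (Ac d) [m, j]"
    unfolding b using br(4)[of "[j]" m] dims_Ac_d shapes by (simp del: block_col.simps)
qed

lemma block_Suc:
  assumes i: "0 < i" "Suc i < d"
  shows "dims (block (Suc i)) = [K i, n (Suc i), K (Suc i)]"
    and "j < n (Suc i) \<Longrightarrow> p < k i \<Longrightarrow> m < k (Suc i) \<Longrightarrow>
      entry (block (Suc i)) [p, j, m] = entry (Ac (Suc i)) [p, j, m]"
    and "j < n (Suc i) \<Longrightarrow> p < k i \<Longrightarrow> m < s (Suc i) \<Longrightarrow>
      entry (block (Suc i)) [p, j, k (Suc i) + m] = entry (U (Suc i)) [p, j, m]"
    and "j < n (Suc i) \<Longrightarrow> p < k i \<Longrightarrow> m < k (Suc i) \<Longrightarrow>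
      entry (block (Suc i)) [p, j, k (Suc i) + (s (Suc i) + m)] = entry (X (Suc i)) [p, j, m]"
    and "j < n (Suc i) \<Longrightarrow> p < s i \<Longrightarrow> m < k (Suc i) \<Longrightarrow>
      entry (block (Suc i)) [k i + p, j, m] = 0"
    and "j < n (Suc i) \<Longrightarrow> p < s i \<Longrightarrow> m < s (Suc i) \<Longrightarrow>
      entry (block (Suc i)) [k i + p, j, k (Suc i) + m] = entry (Z (Suc i)) [p, j, m]"
    and "j < n (Suc i) \<Longrightarrow> p < s i \<Longrightarrow> m < k (Suc i) \<Longrightarrow>
      entry (block (Suc i)) [k i + p, j, k (Suc i) + (s (Suc i) + m)] = entry (V (Suc i)) [p, j, m]"
    and "j < n (Suc i) \<Longrightarrow> p < k i \<Longrightarrow> m < k (Suc i) \<Longrightarrow>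
      entry (block (Suc i)) [k i + (s i + p), j, m] = 0"
    and "j < n (Suc i) \<Longrightarrow> p < k i \<Longrightarrow> m < s (Suc i) \<Longrightarrow>
      entry (block (Suc i)) [k i + (s i + p), j, k (Suc i) + m] = 0"
    and "j < n (Suc i) \<Longrightarrow> p < k i \<Longrightarrow> m < k (Suc i) \<Longrightarrow>
      entry (block (Suc i)) [k i + (s i + p), j, k (Suc i) + (s (Suc i) + m)] = entry (Ac (Suc i)) [p, j, m]"
proof -
  let ?r1 = "block_row [Ac (Suc i), U (Suc i), X (Suc i)]"
  let ?r2 = "block_row [zero_tensor [s i, n (Suc i), k (Suc i)], Z (Suc i), V (Suc i)]"
  let ?r3 = "block_row [zero_tensor [k i, n (Suc i), k (Suc i)], zero_tensor [k i, n (Suc i), s (Suc i)], Ac (Suc i)]"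
  have b: "block (Suc i) = block_col [?r1, ?r2, ?r3]"
    using i by (simp add: block_def block_tensor_def del: block_row.simps block_col.simps)
  note sh = shapes(5-)[of i] dims_Ac_Suc[of i] dims_zero_tensor entry_zero_tensor
  note r1 = block_row_3[of "Ac (Suc i)" "[k i, n (Suc i)]" "k (Suc i)" "U (Suc i)" "s (Suc i)" "X (Suc i)" "k (Suc i)"]
  note r2 = block_row_3[of "zero_tensor [s i, n (Suc i), k (Suc i)]" "[s i, n (Suc i)]" "k (Suc i)"
      "Z (Suc i)" "s (Suc i)" "V (Suc i)" "k (Suc i)"]
  note r3 = block_row_3[of "zero_tensor [k i, n (Suc i), k (Suc i)]" "[k i, n (Suc i)]" "k (Suc i)"
      "zero_tensor [k i, n (Suc i), s (Suc i)]" "s (Suc i)" "Ac (Suc i)" "k (Suc i)"]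
  have d1: "dims ?r1 = [k i, n (Suc i), K (Suc i)]"
    using r1(1) sh i by (simp add: K_def del: block_row.simps)
  have d2: "dims ?r2 = [s i, n (Suc i), K (Suc i)]"
    using r2(1) sh i by (simp add: K_def del: block_row.simps)
  have d3: "dims ?r3 = [k i, n (Suc i), K (Suc i)]"
    using r3(1) sh i by (simp add: K_def del: block_row.simps)
  note c = block_col_3[OF d1 d2 d3, folded b]
  show "dims (block (Suc i)) = [K i, n (Suc i), K (Suc i)]" using c(1) by (simp add: K_def)
  have m: "m < k (Suc i) \<Longrightarrow> m < K (Suc i)" "m < s (Suc i) \<Longrightarrow> k (Suc i) + m < K (Suc i)"
    "m < k (Suc i) \<Longrightarrow> k (Suc i) + (s (Suc i) + m) < K (Suc i)" for m
    by (simp_all add: K_def)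
  assume j: "j < n (Suc i)"
  have c1: "entry (block (Suc i)) [p, j, m] = entry ?r1 ([p, j] @ [m])" if "p < k i" "m < K (Suc i)" for p m
    using c(2)[of "[j, m]" p] j that by (simp del: block_row.simps)
  have c2: "entry (block (Suc i)) [k i + p, j, m] = entry ?r2 ([p, j] @ [m])" if "p < s i" "m < K (Suc i)" for p m
    using c(3)[of "[j, m]" p] j that by (simp del: block_row.simps)
  have c3: "entry (block (Suc i)) [k i + (s i + p), j, m] = entry ?r3 ([p, j] @ [m])" if "p < k i" "m < K (Suc i)" for p m
    using c(4)[of "[j, m]" p] j that by (simp del: block_row.simps)
  note sh = sh j i
  show "p < k i \<Longrightarrow> m < k (Suc i) \<Longrightarrow> entry (block (Suc i)) [p, j, m] = entry (Ac (Suc i)) [p, j, m]"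
    using c1[OF _ m(1)] r1(2)[of "[p, j]" m] sh by (simp del: block_row.simps)
  show "p < k i \<Longrightarrow> m < s (Suc i) \<Longrightarrow>
      entry (block (Suc i)) [p, j, k (Suc i) + m] = entry (U (Suc i)) [p, j, m]"
    using c1[OF _ m(2)] r1(3)[of "[p, j]" m] sh by (simp del: block_row.simps)
  show "p < k i \<Longrightarrow> m < k (Suc i) \<Longrightarrow>
      entry (block (Suc i)) [p, j, k (Suc i) + (s (Suc i) + m)] = entry (X (Suc i)) [p, j, m]"
    using c1[OF _ m(3)] r1(4)[of "[p, j]" m] sh by (simp del: block_row.simps)
  show "p < s i \<Longrightarrow> m < k (Suc i) \<Longrightarrow> entry (block (Suc i)) [k i + p, j, m] = 0"
    using c2[OF _ m(1)] r2(2)[of "[p, j]" m] sh by (simp del: block_row.simps)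
  show "p < s i \<Longrightarrow> m < s (Suc i) \<Longrightarrow>
      entry (block (Suc i)) [k i + p, j, k (Suc i) + m] = entry (Z (Suc i)) [p, j, m]"
    using c2[OF _ m(2)] r2(3)[of "[p, j]" m] sh by (simp del: block_row.simps)
  show "p < s i \<Longrightarrow> m < k (Suc i) \<Longrightarrow>
      entry (block (Suc i)) [k i + p, j, k (Suc i) + (s (Suc i) + m)] = entry (V (Suc i)) [p, j, m]"
    using c2[OF _ m(3)] r2(4)[of "[p, j]" m] sh by (simp del: block_row.simps)
  show "p < k i \<Longrightarrow> m < k (Suc i) \<Longrightarrow> entry (block (Suc i)) [k i + (s i + p), j, m] = 0"
    using c3[OF _ m(1)] r3(2)[of "[p, j]" m] sh by (simp del: block_row.simps)
  show "p < k i \<Longrightarrow> m < s (Suc i) \<Longrightarrow> entry (block (Suc i)) [k i + (s i + p), j, k (Suc i) + m] = 0"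
    using c3[OF _ m(2)] r3(3)[of "[p, j]" m] sh by (simp del: block_row.simps)
  show "p < k i \<Longrightarrow> m < k (Suc i) \<Longrightarrow>
      entry (block (Suc i)) [k i + (s i + p), j, k (Suc i) + (s (Suc i) + m)] = entry (Ac (Suc i)) [p, j, m]"
    using c3[OF _ m(3)] r3(4)[of "[p, j]" m] sh by (simp del: block_row.simps)
qed

lemma sum_K: "(\<Sum>m<K i. f m) = (\<Sum>m<k i. f m) + (\<Sum>m<s i. f (k i + m)) + (\<Sum>m<k i. f (k i + (s i + m)))"
  for f :: "nat \<Rightarrow> real"
  by (simp add: K_def sum_lessThan_add)

text \<open>Descending induction from the last core, where the three rows are the blocks
  \<open>X d\<close>, \<open>V d\<close> and \<open>Ac d\<close>. Each earlier core applies
  \<open>Xr_rec\<close>, \<open>Vr_rec\<close> and \<open>R_rec\<close>, one for each block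
  row.\<close>

lemma block_suffix:
  assumes "0 < i" "i < d" "b \<in> J i"
  shows "(\<forall>m<k i. entry (tt_prod (map block [Suc i..<Suc d])) (m # b) = T.Xr i m b) \<and>
    (\<forall>m<s i. entry (tt_prod (map block [Suc i..<Suc d])) ((k i + m) # b) = T.Vr i m b) \<and>
    (\<forall>m<k i. entry (tt_prod (map block [Suc i..<Suc d])) ((k i + (s i + m)) # b) = R i m b)"
  using assms
proof (induction "d - i" arbitrary: i b rule: less_induct)
  case less
  show ?case
  proof (cases "Suc i = d")
    case True
    then have l: "[Suc i..<Suc d] = [d]" and di: "d - 1 = i" by (auto simp: upt_conv_Cons)
    from less.prems(3) obtain j where j: "b = [j]" "j < n d"
      unfolding l by (auto simp: in_multi_indices_Cons)
    show ?thesis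
      unfolding R_pos[OF less.prems(1)] l using block_d(2-4)[of j] entries_d[of _ j] j di by simp
  next
    case False
    then have i: "0 < i" "Suc i < d" using less by auto
    from less.prems(3) obtain j b' where b: "b = j # b'" "j < n (Suc i)" "b' \<in> J (Suc i)"
      unfolding J_Suc[OF less.prems(2)] by (auto simp: in_multi_indices_Cons)
    let ?S = "\<lambda>m. entry (tt_prod (map block [Suc (Suc i)..<Suc d])) (m # b')"
    have S: "\<And>m. m < k (Suc i) \<Longrightarrow> ?S m = T.Xr (Suc i) m b'"
      "\<And>m. m < s (Suc i) \<Longrightarrow> ?S (k (Suc i) + m) = T.Vr (Suc i) m b'"
      "\<And>m. m < k (Suc i) \<Longrightarrow> ?S (k (Suc i) + (s (Suc i) + m)) = R (Suc i) m b'"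
      using less.hyps[of "Suc i" b'] i b by auto
    \<comment> \<open>The sum over the interface is split into its three ranges and the induction
      hypothesis is inserted; \<open>p\<close> may lie in any block row.\<close>
    have E: "entry (tt_prod (map block [Suc i..<Suc d])) (p # b) =
      (\<Sum>m<k (Suc i). entry (block (Suc i)) [p, j, m] * T.Xr (Suc i) m b') +
      (\<Sum>m<s (Suc i). entry (block (Suc i)) [p, j, k (Suc i) + m] * T.Vr (Suc i) m b') +
      (\<Sum>m<k (Suc i). entry (block (Suc i)) [p, j, k (Suc i) + (s (Suc i) + m)] * R (Suc i) m b')"
      if "p < K i" for p
    proof -
      have "entry (tt_prod (map block [Suc i..<Suc d])) (p # b) =
        (\<Sum>m<K (Suc i). entry (block (Suc i)) [p, j, m] * ?S m)"
        unfolding b(1) by (rule entry_tt_prod_suffix[OF i(2,1) block_Suc(1) block_d(1) that b(2,3)])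
      then show ?thesis unfolding sum_K using S by simp
    qed
    have \<kappa>': "\<kappa> i = k i" "\<kappa> (Suc i) = k (Suc i)" and \<sigma>': "\<sigma> i = s i" "\<sigma> (Suc i) = s (Suc i)"
      using i by (simp_all add: \<kappa>_def \<sigma>)
    have core: "core (Suc i) p j m = entry (Ac (Suc i)) [p, j, m]" for p m
      using i by (simp add: core_def)
    have "entry (tt_prod (map block [Suc i..<Suc d])) (m # b) = T.Xr i m b" if "m < k i" for m
      using E[of m] T.Xr_rec[OF i(2) _ b(2,3), of m] that block_Suc(2-4)[OF i b(2)] entries_Suc(1,2)[OF i b(2)]
      by (simp add: K_def \<kappa>' \<sigma>' core b(1) del: T.Uf.simps T.Xf.simps)
    moreover have "entry (tt_prod (map block [Suc i..<Suc d])) ((k i + m) # b) = T.Vr i m b" if "m < s i" for m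
      using E[of "k i + m"] T.Vr_rec[OF i(2,1) _ b(2,3), of m] that block_Suc(5-7)[OF i b(2)] entries_Suc(3,4)[OF i b(2)]
      by (simp add: K_def \<kappa>' \<sigma>' b(1) del: T.Zf.simps T.Vf.simps)
    moreover have "entry (tt_prod (map block [Suc i..<Suc d])) ((k i + (s i + m)) # b) = R i m b" if "m < k i" for m
      using E[of "k i + (s i + m)"] R_rec[OF i(2) _ b(2,3), of m] that block_Suc(8-10)[OF i b(2)]
      by (simp add: K_def \<kappa>' core b(1))
    ultimately show ?thesis by simp
  qed
qed

text \<open>The first core consists of the top block row only, so the product is the first row of
  \<open>block_suffix\<close> carried from level 1 to level 0.\<close>

lemma X_eq_block_prod: "\<X> = tt_prod (map block [1..<Suc d])"
proof (rule tensor_eqI)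
  have l: "[1..<Suc d] = 1 # [Suc 1..<Suc d]" using d by (simp add: upt_conv_Cons)
  have ds: "dims (tt_prod (map block [Suc 1..<Suc d])) = K 1 # map n [Suc 1..<Suc d]"
    using d by (intro dims_tt_prod_suffix block_Suc(1) block_d(1)) auto
  show "dims \<X> = dims (tt_prod (map block [1..<Suc d]))"
  proof -
    have "tt_prod (map block [1..<Suc d]) = block 1 \<star> tt_prod (map block [Suc 1..<Suc d])"
      using d by (intro tt_prod_upt) simp
    then show ?thesis using block_1(1) ds unfolding dims_X by (simp add: l[unfolded One_nat_def])
  qed
  fix js assume "js \<in> multi_indices (dims \<X>)"
  then obtain j b where js: "js = j # b" "j < n 1" "b \<in> J 1"
    unfolding dims_X l by (auto simp: in_multi_indices_Cons)
  have d1: "Suc 0 < d" using d by simp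
  have "entry (tt_prod (map block [1..<Suc d])) js =
    (\<Sum>m<K 1. entry (block 1) [j, m] * entry (tt_prod (map block [Suc 1..<Suc d])) (m # b))"
    unfolding js(1)
    by (rule entry_tt_prod_first[OF d block_1(1) block_Suc(1) block_d(1) js(2,3)])
  also have "\<dots> = (\<Sum>m<k 1. entry (Ac 1) [j, m] * T.Xr 1 m b) +
      (\<Sum>m<s 1. T.Uf 1 0 j m * T.Vr 1 m b) + (\<Sum>m<k 1. T.Xf 1 0 j m * R 1 m b)"
    unfolding sum_K using block_suffix[of 1 b] d js block_1(2-4)[of j] entries_1[of j] by simp
  \<comment> \<open>At level 0 the left factor is the scalar 1 and the only left multi-index is
    empty, so \<open>Xr 0 0\<close> is the tangent vector.\<close>
  also have "\<dots> = T.Xr 0 0 js"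
    using T.Xr_rec[OF d1, of 0 j b] js by (simp add: \<kappa>_def \<sigma> core_def)
  also have "\<dots> = entry \<X> js" by (simp add: T.Xr_def)
  finally show "entry \<X> js = entry (tt_prod (map block [1..<Suc d])) js" ..
qed

lemma blocks_list: "map block [1..<Suc d] =
  [block_tensor [[Ac 1, U 1, X 1]]] @
         map (\<lambda>i. block_tensor
           [[Ac i,                               U i,                                X i],
            [zero_tensor [s (i-1), n i, k i],    Z i,                                V i],
            [zero_tensor [k (i-1), n i, k i],    zero_tensor [k (i-1), n i, s i],    Ac i]])
           [2..<d] @
         [block_tensor [[X d], [V d], [Ac d]]]"
proof -
  have "[1..<Suc d] = [1] @ [2..<d] @ [d]"
    using d by (simp add: upt_Suc upt_conv_Cons[of "Suc 0"] numeral_2_eq_2)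
  moreover have "map block [2..<d] = map (\<lambda>i. block_tensor
           [[Ac i,                               U i,                                X i],
            [zero_tensor [s (i-1), n i, k i],    Z i,                                V i],
            [zero_tensor [k (i-1), n i, k i],    zero_tensor [k (i-1), n i, s i],    Ac i]])
           [2..<d]"
    by (rule map_cong[OF refl]) (simp add: block_def)
  moreover have "block 1 = block_tensor [[Ac 1, U 1, X 1]]" "block d = block_tensor [[X d], [V d], [Ac d]]"
    using d by (simp_all add: block_def)
  ultimately show ?thesis by simp
qed

text \<open>\<open>right_mat_Ac_mult\<close> reduces every entry of the product to the sum in
  \<open>Uf_orth\<close>; \<open>X_right_orth\<close> follows the same pattern.\<close>

lemma U_right_orth:
  assumes "i \<in> {1..d-1}"
  shows "(right_mat (Ac i))\<^sup>T * right_mat (U i) = 0\<^sub>m (k i) (s i)"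
proof -
  obtain l where l: "i = Suc l" "Suc l < d" using assms d by (cases i) auto
  have dU: "dims (U (Suc l)) = (if l = 0 then [n 1, s (Suc l)] else [k l, n (Suc l), s (Suc l)])"
    using shapes(1) shapes(5)[of l] l by simp
  have rows: "dim_col (right_mat (Ac (Suc l))) = k (Suc l)" "dim_col (right_mat (U (Suc l))) = s (Suc l)"
    using dims_Ac_1 dims_Ac_Suc[of l] dU l
    by (auto simp: right_mat_def matricize_def split: if_splits)
  show ?thesis unfolding l
  proof (rule eq_matI)
    fix q q' assume "q < dim_row (0\<^sub>m (k (Suc l)) (s (Suc l)) :: real mat)"
      "q' < dim_col (0\<^sub>m (k (Suc l)) (s (Suc l)) :: real mat)"
    then have q: "q < k (Suc l)" "q' < s (Suc l)" by simp_all
    have "((right_mat (Ac (Suc l)))\<^sup>T * right_mat (U (Suc l))) $$ (q, q') =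
      (\<Sum>p<\<kappa> l. \<Sum>j<n (Suc l). core (Suc l) p j q * T.Uf (Suc l) p j q')"
      unfolding right_mat_Ac_mult[OF l(2) dU q]
      using entries_1(1)[of _ q'] entries_Suc(1)[of l _ _ q'] l q
      by (intro sum.cong refl arg_cong[where f = "(*) _"]) (auto simp: \<kappa>_def simp del: T.Uf.simps)
    then show "((right_mat (Ac (Suc l)))\<^sup>T * right_mat (U (Suc l))) $$ (q, q') = 0\<^sub>m (k (Suc l)) (s (Suc l)) $$ (q, q')"
      using T.Uf_orth[OF l(2), of q q'] q by (simp add: \<kappa>_def \<sigma>)
  qed (simp_all add: rows)
qed

lemma X_right_orth:
  assumes "i \<in> {1..d-1}"
  shows "(right_mat (Ac i))\<^sup>T * right_mat (X i) = 0\<^sub>m (k i) (k i)"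
proof -
  obtain l where l: "i = Suc l" "Suc l < d" using assms d by (cases i) auto
  have dX: "dims (X (Suc l)) = (if l = 0 then [n 1, k (Suc l)] else [k l, n (Suc l), k (Suc l)])"
    using shapes(2) shapes(6)[of l] l by simp
  have rows: "dim_col (right_mat (Ac (Suc l))) = k (Suc l)" "dim_col (right_mat (X (Suc l))) = k (Suc l)"
    using dims_Ac_1 dims_Ac_Suc[of l] dX l
    by (auto simp: right_mat_def matricize_def split: if_splits)
  show ?thesis unfolding l
  proof (rule eq_matI)
    fix q q' assume "q < dim_row (0\<^sub>m (k (Suc l)) (k (Suc l)) :: real mat)"
      "q' < dim_col (0\<^sub>m (k (Suc l)) (k (Suc l)) :: real mat)"
    then have q: "q < k (Suc l)" "q' < k (Suc l)" by simp_all
    have "((right_mat (Ac (Suc l)))\<^sup>T * right_mat (X (Suc l))) $$ (q, q') =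
      (\<Sum>p<\<kappa> l. \<Sum>j<n (Suc l). core (Suc l) p j q * T.Xf (Suc l) p j q')"
      unfolding right_mat_Ac_mult[OF l(2) dX q]
      using entries_1(2)[of _ q'] entries_Suc(2)[of l _ _ q'] l q
      by (intro sum.cong refl arg_cong[where f = "(*) _"]) (auto simp: \<kappa>_def simp del: T.Xf.simps)
    then show "((right_mat (Ac (Suc l)))\<^sup>T * right_mat (X (Suc l))) $$ (q, q') = 0\<^sub>m (k (Suc l)) (k (Suc l)) $$ (q, q')"
      using T.Xf_orth[OF l(2), of q q'] q by (simp add: \<kappa>_def)
  qed (simp_all add: rows)
qed

text \<open>For the last core \<open>V d\<close> is \<open>Vr\<close> and \<open>Vr_orth\<close>
  applies; for a middle core the product with the following cores is \<open>Vf\<close> times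
  \<open>R\<close>, and \<open>Vf_orth\<close> applies. The level is
  \<open>l = i - 1\<close>.\<close>

lemma V_left_orth:
  assumes "i \<in> {2..d}"
  shows "left_mat (tt_prod (V i # map Ac [Suc i..<Suc d])) * (left_mat (tt_prod (map Ac [i..<Suc d])))\<^sup>T =
    0\<^sub>m (s (i - 1)) (k (i - 1))"
proof -
  obtain l where l: "i = Suc l" "0 < l" "l < d" using assms by (cases i) auto
  let ?VA = "tt_prod (V (Suc l) # map Ac [Suc (Suc l)..<Suc d])"
  have dA: "dims (tt_prod (map Ac [Suc l..<Suc d])) = k l # map n [Suc l..<Suc d]"
    using l by (intro dims_tt_prod_suffix dims_Ac_Suc dims_Ac_d)
  have "dims ?VA = s l # map n [Suc l..<Suc d] \<and>
    (\<forall>x<s l. \<forall>y<k l. (\<Sum>b\<in>J l. entry ?VA (x # b) * R l y b) = 0)"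
  proof (cases "Suc l = d")
    case True
    then have u: "[Suc (Suc l)..<Suc d] = []" "[Suc l..<Suc d] = [d]" and dl: "d - 1 = l"
      by (auto simp: upt_conv_Cons)
    have "(\<Sum>b\<in>J l. entry (V d) (x # b) * R l y b) = 0" if "x < s l" "y < k l" for x y
    proof -
      have "(\<Sum>b\<in>J l. entry (V d) (x # b) * R l y b) = (\<Sum>b\<in>J l. T.Vr l x b * R l y b)"
        using entries_d(2)[of x] that dl unfolding u
        by (intro sum.cong refl) (auto simp: in_multi_indices_Cons)
      then show ?thesis using T.Vr_orth[OF l(2,3), of y x] that l by (simp add: \<kappa>_def)
    qed
    then show ?thesis using shapes(4) True u dl by simp
  next
    case False
    then have sl: "Suc l < d" using l by simp
    have VA: "?VA = V (Suc l) \<star> tt_prod (map Ac [Suc (Suc l)..<Suc d])"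
      using sl by (simp add: upt_conv_Cons[of "Suc (Suc l)"])
    have dA': "dims (tt_prod (map Ac [Suc (Suc l)..<Suc d])) = k (Suc l) # map n [Suc (Suc l)..<Suc d]"
      using sl by (intro dims_tt_prod_suffix dims_Ac_Suc dims_Ac_d) auto
    have "(\<Sum>b\<in>J l. entry ?VA (x # b) * R l y b) = 0" if xy: "x < s l" "y < k l" for x y
    proof -
      have e: "entry ?VA (x # j # b) = (\<Sum>q<\<kappa> (Suc l). T.Vf (Suc l) x j q * R (Suc l) q b)"
        if "j < n (Suc l)" "b \<in> J (Suc l)" for j b
      proof -
        have "entry ?VA ([x, j] @ b) =
          (\<Sum>m<k (Suc l). entry (V (Suc l)) ([x, j] @ [m]) * entry (tt_prod (map Ac [Suc (Suc l)..<Suc d])) (m # b))"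
          unfolding VA
          by (rule entry_tt_mult[where ns = "[s l, n (Suc l)]", OF _ dA']) (use shapes(8) sl that xy in simp_all)
        then show ?thesis using entries_Suc(4)[OF l(2) sl that(1) xy(1)]
          by (simp add: \<kappa>_def R_pos del: T.Vf.simps)
      qed
      have "(\<Sum>b\<in>J l. entry ?VA (x # b) * R l y b) = (\<Sum>j<n (Suc l). \<Sum>b\<in>J (Suc l).
        (\<Sum>q<\<kappa> (Suc l). T.Vf (Suc l) x j q * R (Suc l) q b) * R l y (j # b))"
        unfolding sum_J_Suc[OF l(3)] using e by (intro sum.cong refl) simp
      then show ?thesis using T.Vf_orth[OF sl l(2), of x y] xy l by (simp add: \<kappa>_def \<sigma>)
    qed
    moreover have "dims ?VA = s l # map n [Suc l..<Suc d]"
      unfolding VA using shapes(8)[OF sl] dA' l by (simp add: J_Suc)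
    ultimately show ?thesis by simp
  qed
  then have dV: "dims ?VA = s l # map n [Suc l..<Suc d]"
    and orth: "\<And>x y. x < s l \<Longrightarrow> y < k l \<Longrightarrow> (\<Sum>b\<in>J l. entry ?VA (x # b) * R l y b) = 0" by auto
  show ?thesis unfolding l left_mat_mult_transpose[OF dV dA]
    using orth by (intro eq_matI) (simp_all add: R_pos[OF l(2), symmetric])
qed

end

end

text \<open>The data \<open>W\<close> and \<open>\<eta>\<close> are chosen at each interface
  independently; the recursions need no compatibility between the choices at different
  levels.\<close>

theorem theorem14:
  fixes d :: nat and n k s :: "nat \<Rightarrow> nat"
    and A \<X> :: tensor and Ac :: "nat \<Rightarrow> tensor"
  assumes "d \<ge> 2"
    and "\<forall>i\<in>{1..d}. n i > 0"
    and "A \<in> tt_manifold (map n [1..<Suc d]) k"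
    and "singular_point (entry ` tt_variety (map n [1..<Suc d]) (\<lambda>i. k i + s i)) (entry A)"
    and "Ac 1 \<in> tensors [n 1, k 1]"
    and "\<forall>i\<in>{2..d-1}. Ac i \<in> tensors [k (i-1), n i, k i]"
    and "Ac d \<in> tensors [k (d-1), n d]"
    and "tt_prod (map Ac [1..<Suc d]) = A"
    and "\<forall>i\<in>{1..d-1}. (right_mat (Ac i))\<^sup>T * right_mat (Ac i) = 1\<^sub>m (k i)"
    and "\<X> \<in> tangent_cone (tt_variety (map n [1..<Suc d]) (\<lambda>i. k i + s i)) A"
  shows "\<exists>U X Z V :: nat \<Rightarrow> tensor.
      U 1 \<in> tensors [n 1, s 1] \<and>
      X 1 \<in> tensors [n 1, k 1] \<and>
      (\<forall>i\<in>{2..d-1}.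
         U i \<in> tensors [k (i-1), n i, s i] \<and>
         X i \<in> tensors [k (i-1), n i, k i] \<and>
         Z i \<in> tensors [s (i-1), n i, s i] \<and>
         V i \<in> tensors [s (i-1), n i, k i]) \<and>
      X d \<in> tensors [k (d-1), n d] \<and>
      V d \<in> tensors [s (d-1), n d] \<and>
      \<X> = tt_prod
        ([block_tensor [[Ac 1, U 1, X 1]]] @
         map (\<lambda>i. block_tensor
           [[Ac i,                               U i,                                X i],
            [zero_tensor [s (i-1), n i, k i],    Z i,                                V i],
            [zero_tensor [k (i-1), n i, k i],    zero_tensor [k (i-1), n i, s i],    Ac i]])
           [2..<d] @
         [block_tensor [[X d], [V d], [Ac d]]]) \<and>
      (\<forall>i\<in>{1..d-1}. (right_mat (Ac i))\<^sup>T * right_mat (U i) = 0\<^sub>m (k i) (s i)) \<and>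
      (\<forall>i\<in>{1..d-1}. (right_mat (Ac i))\<^sup>T * right_mat (X i) = 0\<^sub>m (k i) (k i)) \<and>
      (\<forall>i\<in>{2..d}. left_mat (tt_prod (V i # map Ac [Suc i..<Suc d])) *
           (left_mat (tt_prod (map Ac [i..<Suc d])))\<^sup>T = 0\<^sub>m (s (i-1)) (k (i-1)))"
proof -
  interpret S: tt_setting d n k A Ac
    using assms by unfold_locales
  \<comment> \<open>The bounds on \<open>i\<close> are a premise inside the formula, so that a
    choice function on all natural numbers exists.\<close>
  have "\<exists>W \<eta>. 0 < i \<and> i < d \<longrightarrow>
      (\<forall>p<k i. \<forall>q<s i. (\<Sum>a\<in>S.I i. S.L i a p * W a q) = 0) \<and>
      (\<forall>a\<in>S.I i. \<forall>q<k i.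
        (\<Sum>b\<in>S.J i. (entry \<X> (a @ b) - (\<Sum>q<k i. \<eta> a q * S.R i q b)) * S.R i q b) = 0) \<and>
      (\<forall>a\<in>S.I i. \<forall>b\<in>S.J i. entry \<X> (a @ b) - (\<Sum>q<k i. \<eta> a q * S.R i q b) =
        (\<Sum>p<k i. S.L i a p * (\<Sum>a'\<in>S.I i. S.L i a' p * (entry \<X> (a' @ b) - (\<Sum>q<k i. \<eta> a' q * S.R i q b)))) +
        (\<Sum>p<s i. W a p * (\<Sum>a'\<in>S.I i. W a' p * (entry \<X> (a' @ b) - (\<Sum>q<k i. \<eta> a' q * S.R i q b)))))"
    (is "\<exists>W \<eta>. ?P i W \<eta>") for i
  proof (cases "0 < i \<and> i < d")
    case True
    show ?thesis
    proof (rule S.tangent_cone_residual[OF assms(10), of i], goal_cases)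
      case (3 W \<eta>)
      show ?case by (intro exI[of _ W] exI[of _ \<eta>] impI conjI allI ballI) (rule 3; assumption)+
    qed (use True in auto)
  qed auto
  then obtain W where "\<forall>i. \<exists>\<eta>. ?P i (W i) \<eta>" using choice[of "\<lambda>i W. \<exists>\<eta>. ?P i W \<eta>"] by blast
  from choice[OF this] obtain \<eta> where P: "\<forall>i. ?P i (W i) (\<eta> i)" ..
  \<comment> \<open>Agrees with \<open>s\<close> at the interfaces; the value 0 at level 0 is a
    default.\<close>
  define \<sigma> where "\<sigma> i = (if i = 0 then 0 else s i)" for i
  have \<sigma>: "\<forall>i>0. \<sigma> i = s i" by (simp add: \<sigma>_def)
  have T: "tt_tangent d n S.\<kappa> S.core S.R \<sigma> W \<eta> (entry \<X>)"
  proof (unfold_locales, goal_cases)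
    case (1 i p q)
    then show ?case using P[rule_format, of i, THEN conjunct1] by (simp add: S.\<kappa>_def \<sigma>_def)
  next
    case (2 i a q)
    then show ?case using P[rule_format, of i, THEN conjunct2, THEN conjunct1] by (simp add: S.\<kappa>_def)
  next
    case (3 i a b)
    have "S.\<kappa> i = k i" "\<sigma> i = s i" using 3 by (simp_all add: S.\<kappa>_def \<sigma>_def)
    then show ?case using P[rule_format, of i, THEN conjunct2, THEN conjunct2, rule_format, of a b] 3
      by (simp only:)
  qed
  have dX: "dims \<X> = map n [1..<Suc d]"
    using assms(10) S.dims_A by (simp add: tangent_cone_def tensors_def)
  note facts = T \<sigma> dX
  note sh = S.shapes[OF facts]
  have mid: "S.U s W i \<in> tensors [k (i-1), n i, s i]" "S.X \<eta> \<X> i \<in> tensors [k (i-1), n i, k i]"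
    "S.Z s W i \<in> tensors [s (i-1), n i, s i]" "S.V s W \<eta> \<X> i \<in> tensors [s (i-1), n i, k i]"
    if i: "i \<in> {2..d-1}" for i
  proof -
    obtain l where l: "i = Suc l" "0 < l" "Suc l < d" using i assms(1) by (cases i) auto
    show "S.U s W i \<in> tensors [k (i-1), n i, s i]" "S.X \<eta> \<X> i \<in> tensors [k (i-1), n i, k i]"
      "S.Z s W i \<in> tensors [s (i-1), n i, s i]" "S.V s W \<eta> \<X> i \<in> tensors [s (i-1), n i, k i]"
      using sh(5-8)[of l] l by (simp_all add: tensors_def)
  qed
  have ends: "S.U s W 1 \<in> tensors [n 1, s 1]" "S.X \<eta> \<X> 1 \<in> tensors [n 1, k 1]"
    "S.X \<eta> \<X> d \<in> tensors [k (d-1), n d]" "S.V s W \<eta> \<X> d \<in> tensors [s (d-1), n d]"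
    using sh(1-4) by (simp_all add: tensors_def)
  show ?thesis
    \<comment> \<open>Outside their context the block definitions take the data they depend on as
      arguments.\<close>
    by (intro exI[of _ "S.U s W"] exI[of _ "S.X \<eta> \<X>"] exI[of _ "S.Z s W"] exI[of _ "S.V s W \<eta> \<X>"]
        conjI ballI ends mid S.X_eq_block_prod[OF facts, unfolded S.blocks_list[OF facts]]
        S.U_right_orth[OF facts] S.X_right_orth[OF facts] S.V_left_orth[OF facts])
qed

end
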